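(* For any composition $\alpha$, the key polynomial $\kappa_\alpha$ satisfies \[\kappa_\alpha(1,\ldots,1)\ \geq\ 1+\sum_{(i,j)\in\mathrm{rinv}(\alpha)}(\alpha_j-\alpha_i).\]
   Context: A composition is a sequence $\alpha=(\alpha_1,\alpha_2,\ldots)$ of nonnegative integers with finitely many nonzero entries. The divided difference operator $\partial_i$ acts on polynomials in $x_1,x_2,\ldots$ by \[\partial_i(f)=\frac{f-s_i\cdot f}{x_i-x_{i+1}},\] where $s_i\cdot f$ is obtained from $f$ by exchanging $x_i$ and $x_{i+1}$. The key polynomial $\kappa_\alpha$ is defined recursively as follows. If $\alpha$ is a partition (i.e. $\alpha_1\geq\alpha_2\geq\cdots$), then $\kappa_\alpha=x^\alpha=\prod_i x_i^{\alpha_i}$. Otherwise, if $\alpha_i<\alpha_{i+1}$ for some $i$, then $\kappa_\alpha=\partial_i(x_i\kappa_\beta)$, where $\beta=(\alpha_1,\ldots,\alpha_{i+1},\alpha_i,\ldots)$ is obtained from $\alpha$ by exchanging the entries $\alpha_i$ and $\alpha_{i+1}$. (This is a well-defined polynomial, independent of choices.) $\kappa_\alpha(1,\ldots,1)$ denotes its value with all variables set to $1$. $\mathrm{rinv}(\alpha)$ denotes the set of right inversions of $\alpha$: the pairs $(i,j)$ with $i<j$ and $\alpha_i<\alpha_j$. *)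

theory Defs
  imports "HOL-Library.Poly_Mapping" "HOL-Combinatorics.Transposition"
begin

text \<open>
  Compositions are finitely supported functions \<open>nat \<Rightarrow>\<^sub>0 nat\<close>, and polynomials in
  infinitely many variables are elements of the monoid ring of compositions over the
  integers, with the monomial \<open>x\<^sup>m\<close> represented by \<open>Poly_Mapping.single m 1\<close>.
  Entries and variables are numbered from 0, so index \<open>i\<close> here is \<open>i + 1\<close> in the usual notation.
\<close>

type_synonym composition = "nat \<Rightarrow>\<^sub>0 nat"
type_synonym mpoly = "composition \<Rightarrow>\<^sub>0 int"

definition var :: "nat \<Rightarrow> mpoly" where
  "var i = Poly_Mapping.single (Poly_Mapping.single i 1) 1"

definition eval_mpoly :: "(nat \<Rightarrow> int) \<Rightarrow> mpoly \<Rightarrow> int" where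
  "eval_mpoly v f =
     (\<Sum>m\<in>Poly_Mapping.keys f. Poly_Mapping.lookup f m *
        (\<Prod>i\<in>Poly_Mapping.keys m. v i ^ Poly_Mapping.lookup m i))"

definition swap_entries :: "nat \<Rightarrow> composition \<Rightarrow> composition" where
  "swap_entries i \<alpha> = Poly_Mapping.map_key (transpose i (Suc i)) \<alpha>"

text \<open>Exchanging two variables sends \<open>x\<^sup>m\<close> to \<open>x\<^sup>m\<close> with the two exponents exchanged
  (see \<open>swap_vars_single\<close> below); as the exchange of exponents is an involution,
  it may be applied to the monomial whose coefficient is looked up.\<close>

definition swap_vars :: "nat \<Rightarrow> mpoly \<Rightarrow> mpoly" where
  "swap_vars i f = Poly_Mapping.map_key (swap_entries i) f"

text \<open>The polynomial quotient of \<open>f - s\<^sub>i f\<close> by \<open>x\<^sub>i - x\<^sub>i\<^sub>+\<^sub>1\<close>; it exists and is unique by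
  \<open>divided_difference_mult\<close> and \<open>divided_difference_unique\<close>.\<close>

definition divided_difference :: "nat \<Rightarrow> mpoly \<Rightarrow> mpoly" where
  "divided_difference i f = (THE g. g * (var i - var (Suc i)) = f - swap_vars i f)"

definition is_partition :: "composition \<Rightarrow> bool" where
  "is_partition \<alpha> \<longleftrightarrow> antimono (Poly_Mapping.lookup \<alpha>)"

text \<open>\<open>is_key_poly \<alpha> p\<close>: some sequence of choices in the recursion produces \<open>p\<close> from \<open>\<alpha>\<close>.
  Independence of the choices is \<open>ex1_is_key_poly\<close>.\<close>

inductive is_key_poly :: "composition \<Rightarrow> mpoly \<Rightarrow> bool" where
  partition: "is_partition \<alpha> \<Longrightarrow> is_key_poly \<alpha> (Poly_Mapping.single \<alpha> 1)"
| ascent: "Poly_Mapping.lookup \<alpha> i < Poly_Mapping.lookup \<alpha> (Suc i) \<Longrightarrow>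
     is_key_poly (swap_entries i \<alpha>) p \<Longrightarrow>
     is_key_poly \<alpha> (divided_difference i (var i * p))"

definition key_poly :: "composition \<Rightarrow> mpoly" where
  "key_poly \<alpha> = (THE p. is_key_poly \<alpha> p)"

definition rinv :: "composition \<Rightarrow> (nat \<times> nat) set" where
  "rinv \<alpha> = {(i, j). i < j \<and> Poly_Mapping.lookup \<alpha> i < Poly_Mapping.lookup \<alpha> j}"

lemma finite_rinv: "finite (rinv \<alpha>)"
proof (rule finite_subset)
  show "rinv \<alpha> \<subseteq> (\<Union>j\<in>Poly_Mapping.keys \<alpha>. {..<j} \<times> {j})"
    by (auto simp: rinv_def in_keys_iff)
qed auto


subsection \<open>Exchange of entries and of variables\<close>

lemma lookup_swap_entries:
  "Poly_Mapping.lookup (swap_entries i \<alpha>) k = Poly_Mapping.lookup \<alpha> (transpose i (Suc i) k)"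
  by (simp add: swap_entries_def map_key.rep_eq)

lemma swap_entries_swap_entries [simp]: "swap_entries i (swap_entries i \<alpha>) = \<alpha>"
  by (rule poly_mapping_eqI) (simp add: lookup_swap_entries)

lemma inj_swap_entries [simp]: "inj (swap_entries i)"
  by (rule inj_on_inverseI) (rule swap_entries_swap_entries)

lemma swap_entries_add: "swap_entries i (m + n) = swap_entries i m + swap_entries i n"
  by (rule poly_mapping_eqI) (simp add: lookup_swap_entries lookup_add)

lemma swap_entries_zero [simp]: "swap_entries i 0 = 0"
  by (rule poly_mapping_eqI) (simp add: lookup_swap_entries)

lemma swap_entries_single:
  "swap_entries i (Poly_Mapping.single k c) = Poly_Mapping.single (transpose i (Suc i) k) c"
  by (rule poly_mapping_eqI)
    (auto simp: lookup_swap_entries lookup_single when_def transpose_eq_iff)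

lemma lookup_swap_vars:
  "Poly_Mapping.lookup (swap_vars i f) m = Poly_Mapping.lookup f (swap_entries i m)"
  by (simp add: swap_vars_def map_key.rep_eq)

lemma swap_vars_single:
  "swap_vars i (Poly_Mapping.single m c) = Poly_Mapping.single (swap_entries i m) c"
  by (rule poly_mapping_eqI) (auto simp: lookup_swap_vars lookup_single when_def)

lemma swap_vars_swap_vars [simp]: "swap_vars i (swap_vars i f) = f"
  by (rule poly_mapping_eqI) (simp add: lookup_swap_vars)

lemma swap_vars_add: "swap_vars i (f + g) = swap_vars i f + swap_vars i g"
  by (rule poly_mapping_eqI) (simp add: lookup_swap_vars lookup_add)

lemma swap_vars_diff: "swap_vars i (f - g) = swap_vars i f - swap_vars i g"
  by (rule poly_mapping_eqI) (simp add: lookup_swap_vars lookup_minus)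

lemma poly_mapping_single_induct [case_names zero single add]:
  assumes "P 0" "\<And>m c. P (Poly_Mapping.single m c)" "\<And>f g. P f \<Longrightarrow> P g \<Longrightarrow> P (f + g)"
  shows "P (f :: 'a \<Rightarrow>\<^sub>0 'b :: comm_monoid_add)"
proof (induction f rule: Poly_Mapping.update_induct)
  case const
  show ?case by (rule assms(1))
next
  case (update f a b)
  have "Poly_Mapping.update a b f = f + Poly_Mapping.single a b"
    using update.hyps
    by (intro poly_mapping_eqI) (auto simp: lookup_update lookup_add lookup_single when_def in_keys_iff)
  thus ?case using assms update.IH by simp
qed

lemma swap_vars_mult: "swap_vars i (f * g) = swap_vars i f * swap_vars i g"
proof (induction f rule: poly_mapping_single_induct)
  case zero
  show ?case by (simp add: swap_vars_def)
next
  case (single m c)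
  show ?case
    by (induction g rule: poly_mapping_single_induct)
      (simp_all add: swap_vars_single mult_single swap_entries_add swap_vars_add
        distrib_left swap_vars_def[of _ 0])
next
  case (add f g)
  thus ?case by (simp add: swap_vars_add distrib_right)
qed

lemma swap_vars_var: "swap_vars i (var k) = var (transpose i (Suc i) k)"
  by (simp add: var_def swap_vars_single swap_entries_single)


subsection \<open>Divided differences\<close>

lemma var_diff_nonzero: "i \<noteq> j \<Longrightarrow> var i - var j \<noteq> 0"
proof
  assume "i \<noteq> j" "var i - var j = 0"
  hence "Poly_Mapping.single i (1::nat) = Poly_Mapping.single j 1"
    unfolding var_def
    by (metis eq_iff_diff_eq_0 lookup_single_eq lookup_single_not_eq zero_neq_one)
  with \<open>i \<noteq> j\<close> show False
    by (metis lookup_single_eq lookup_single_not_eq zero_neq_one)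
qed

lemma dvd_minus_swap_vars: "var i - var (Suc i) dvd f - swap_vars i f"
proof -
  let ?d = "var i - var (Suc i)"
  have closed_mult: "?d dvd f * g - swap_vars i (f * g)"
    if "?d dvd f - swap_vars i f" "?d dvd g - swap_vars i g" for f g
  proof -
    have "f * g - swap_vars i (f * g) =
        f * (g - swap_vars i g) + swap_vars i g * (f - swap_vars i f)"
      by (simp add: swap_vars_mult algebra_simps)
    thus ?thesis using that by simp
  qed
  have single_var: "?d dvd var k - swap_vars i (var k)" for k
  proof -
    have "?d dvd var (Suc i) - var i"
      by (metis dvd_minus_iff dvd_refl minus_diff_eq)
    thus ?thesis by (auto simp: swap_vars_var transpose_def)
  qed
  have const: "?d dvd f - swap_vars i f" if "f = Poly_Mapping.single 0 c" for f c
    using that by (simp add: swap_vars_single)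
  have pow: "?d dvd Poly_Mapping.single (Poly_Mapping.single k n) 1 -
      swap_vars i (Poly_Mapping.single (Poly_Mapping.single k n) 1)" for k n
  proof (induction n)
    case 0
    show ?case by (rule const[of _ 1]) simp
  next
    case (Suc n)
    have "Poly_Mapping.single (Poly_Mapping.single k (Suc n)) (1::int) =
        var k * Poly_Mapping.single (Poly_Mapping.single k n) 1"
      by (simp add: var_def mult_single flip: single_add)
    thus ?case using closed_mult[OF single_var Suc] by simp
  qed
  have mono: "?d dvd Poly_Mapping.single m 1 - swap_vars i (Poly_Mapping.single m 1)" for m
  proof (induction m rule: poly_mapping_single_induct)
    case zero
    show ?case by (rule const[of _ 1]) simp
  next
    case (single k n)
    show ?case by (rule pow)
  next
    case (add m n)
    thus ?case using closed_mult[OF add] by (simp add: mult_single)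
  qed
  show ?thesis
  proof (induction f rule: poly_mapping_single_induct)
    case zero
    show ?case by (simp add: swap_vars_def)
  next
    case (single m c)
    show ?case using closed_mult[OF const mono, OF refl, of c m] by (simp add: mult_single)
  next
    case (add f g)
    have "f + g - swap_vars i (f + g) = (f - swap_vars i f) + (g - swap_vars i g)"
      by (simp add: swap_vars_add)
    thus ?case using add by (simp only: dvd_add)
  qed
qed

lemma divided_difference_unique:
  assumes "g * (var i - var (Suc i)) = f - swap_vars i f"
  shows "divided_difference i f = g"
  unfolding divided_difference_def
proof (rule the_equality)
  fix h assume "h * (var i - var (Suc i)) = f - swap_vars i f"
  thus "h = g" using assms var_diff_nonzero[of i "Suc i"] by (metis mult_cancel_right n_not_Suc_n)
qed (rule assms)

lemma divided_difference_mult: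
  "divided_difference i f * (var i - var (Suc i)) = f - swap_vars i f"
proof -
  obtain g where "f - swap_vars i f = (var i - var (Suc i)) * g"
    using dvd_minus_swap_vars by (blast elim: dvdE)
  hence "g * (var i - var (Suc i)) = f - swap_vars i f" by (simp add: mult.commute)
  thus ?thesis using divided_difference_unique by simp
qed


subsection \<open>The operators \<open>f \<mapsto> \<partial>\<^sub>i (x\<^sub>i f)\<close> and their braid relations\<close>

abbreviation dem :: "nat \<Rightarrow> mpoly \<Rightarrow> mpoly" where
  "dem i f \<equiv> divided_difference i (var i * f)"

lemma dem_mult: "(var i - var (Suc i)) * dem i f = var i * f - var (Suc i) * swap_vars i f"
  using divided_difference_mult[of i "var i * f"]
  by (simp add: swap_vars_mult swap_vars_var mult.commute)

lemma swap_vars_dem: "swap_vars i (dem i f) = dem i f"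
proof -
  have "swap_vars i ((var i - var (Suc i)) * dem i f) =
      swap_vars i (var i * f - var (Suc i) * swap_vars i f)"
    by (simp only: dem_mult)
  hence "(var (Suc i) - var i) * swap_vars i (dem i f) =
      var (Suc i) * swap_vars i f - var i * f"
    by (simp add: swap_vars_mult swap_vars_diff swap_vars_var)
  also have "\<dots> = (var (Suc i) - var i) * dem i f"
    using dem_mult[of i f] by (metis minus_diff_eq minus_mult_left)
  finally show ?thesis using var_diff_nonzero[of "Suc i" i] by simp
qed

lemma swap_entries_braid:
  "swap_entries i (swap_entries (Suc i) (swap_entries i \<alpha>)) =
   swap_entries (Suc i) (swap_entries i (swap_entries (Suc i) \<alpha>))"
  by (rule poly_mapping_eqI) (simp add: lookup_swap_entries transpose_def)

lemma swap_entries_commute: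
  "Suc i < j \<Longrightarrow> swap_entries i (swap_entries j \<alpha>) = swap_entries j (swap_entries i \<alpha>)"
  by (rule poly_mapping_eqI) (auto simp: lookup_swap_entries transpose_def)

lemma swap_vars_braid:
  "swap_vars i (swap_vars (Suc i) (swap_vars i f)) =
   swap_vars (Suc i) (swap_vars i (swap_vars (Suc i) f))"
  by (rule poly_mapping_eqI) (simp add: lookup_swap_vars swap_entries_braid)

lemma swap_vars_commute:
  "Suc i < j \<Longrightarrow> swap_vars i (swap_vars j f) = swap_vars j (swap_vars i f)"
  by (rule poly_mapping_eqI) (metis lookup_swap_vars swap_entries_commute)

lemma dem_commute:
  assumes "Suc i < j"
  shows "dem i (dem j f) = dem j (dem i f)"
proof -
  define a b c d where "a = var i" and "b = var (Suc i)" and "c = var j" and "d = var (Suc j)"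
  note defs = a_def b_def c_def d_def
  have fix_i: "swap_vars i c = c" "swap_vars i d = d" and fix_j: "swap_vars j a = a" "swap_vars j b = b"
    using assms by (auto simp: defs swap_vars_var transpose_def)
  let ?s = "swap_vars i" and ?t = "swap_vars j"
  have j: "(c - d) * dem j g = c * g - d * ?t g" for g unfolding defs by (rule dem_mult)
  have i: "(a - b) * dem i g = a * g - b * ?s g" for g unfolding defs by (rule dem_mult)
  have sj: "(c - d) * ?s (dem j f) = c * ?s f - d * ?s (?t f)"
    using arg_cong[OF j[of f], of ?s] by (simp add: swap_vars_mult swap_vars_diff fix_i)
  have ti: "(a - b) * ?t (dem i f) = a * ?t f - b * ?s (?t f)"
    using arg_cong[OF i[of f], of ?t] swap_vars_commute[OF assms]
    by (simp add: swap_vars_mult swap_vars_diff fix_j)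
  have "(a - b) * (c - d) * dem i (dem j f) = (c - d) * (a * dem j f - b * ?s (dem j f))"
    by (simp only: i[symmetric] mult_ac)
  also have "\<dots> = a * (c * f - d * ?t f) - b * (c * ?s f - d * ?s (?t f))"
    by (simp only: j[of f, symmetric] sj[symmetric]) (simp add: algebra_simps)
  also have "\<dots> = c * (a * f - b * ?s f) - d * (a * ?t f - b * ?s (?t f))"
    by (simp add: algebra_simps)
  also have "\<dots> = (a - b) * (c * dem i f - d * ?t (dem i f))"
    by (simp only: i[of f, symmetric] ti[symmetric]) (simp add: algebra_simps)
  also have "\<dots> = (a - b) * (c - d) * dem j (dem i f)"
    by (simp only: j[symmetric] mult_ac)
  finally show ?thesis
    using var_diff_nonzero[of i "Suc i"] var_diff_nonzero[of j "Suc j"] by (simp add: defs)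
qed

lemma dem_braid: "dem i (dem (Suc i) (dem i f)) = dem (Suc i) (dem i (dem (Suc i) f))"
proof -
  define a b c where "a = var i" and "b = var (Suc i)" and "c = var (Suc (Suc i))"
  note defs = a_def b_def c_def
  let ?s = "swap_vars i" and ?t = "swap_vars (Suc i)"
  have sv: "?s a = b" "?s b = a" "?s c = c" and tv: "?t a = a" "?t b = c" "?t c = b"
    by (auto simp: defs swap_vars_var transpose_def)
  note hom = swap_vars_mult swap_vars_diff sv tv
  have S: "(a - b) * dem i g = a * g - b * ?s g" for g unfolding defs by (rule dem_mult)
  have T: "(b - c) * dem (Suc i) g = b * g - c * ?t g" for g unfolding defs by (rule dem_mult)
  define V where "V = (a - b) * (a - c) * (b - c)"
  define R where "R = a * a * b * f - a * b * b * ?s f - a * a * c * ?t f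
    + a * c * c * ?t (?s f) + b * b * c * ?s (?t f) - b * c * c * ?s (?t (?s f))"

  define g where "g = dem i f"
  define h where "h = dem (Suc i) g"
  have sg: "?s g = g" unfolding g_def by (rule swap_vars_dem)
  have e1: "(a - b) * g = a * f - b * ?s f" unfolding g_def by (rule S)
  have e2: "(a - c) * ?t g = a * ?t f - c * ?t (?s f)"
    using arg_cong[OF e1, of ?t] by (simp add: hom)
  have e3: "(b - c) * ?s (?t g) = b * ?s (?t f) - c * ?s (?t (?s f))"
    using arg_cong[OF e2, of ?s] by (simp add: hom)
  have e4: "(b - c) * h = b * g - c * ?t g" unfolding h_def by (rule T)
  have e5: "(a - c) * ?s h = a * g - c * ?s (?t g)"
    using arg_cong[OF e4, of ?s] by (simp add: hom sg)
  have e6: "(a - b) * dem i h = a * h - b * ?s h" by (rule S)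
  have "V * dem i h = (a - c) * (b - c) * ((a - b) * dem i h)"
    by (simp add: V_def mult_ac)
  also have "\<dots> = (a - c) * a * ((b - c) * h) - (b - c) * b * ((a - c) * ?s h)"
    by (simp only: e6) (simp add: algebra_simps)
  also have "\<dots> = a * b * ((a - b) * g) - a * c * ((a - c) * ?t g) + b * c * ((b - c) * ?s (?t g))"
    by (simp only: e4 e5) (simp add: algebra_simps)
  also have "\<dots> = R"
    by (simp only: e1 e2 e3 R_def) (simp add: algebra_simps)
  finally have 1: "V * dem i (dem (Suc i) (dem i f)) = R" by (simp add: g_def h_def)

  define g' where "g' = dem (Suc i) f"
  define h' where "h' = dem i g'"
  have tg': "?t g' = g'" unfolding g'_def by (rule swap_vars_dem)
  have d1: "(b - c) * g' = b * f - c * ?t f" unfolding g'_def by (rule T)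
  have d2: "(a - c) * ?s g' = a * ?s f - c * ?s (?t f)"
    using arg_cong[OF d1, of ?s] by (simp add: hom)
  have d3: "(a - b) * ?t (?s g') = a * ?t (?s f) - b * ?s (?t (?s f))"
    using arg_cong[OF d2, of ?t] by (simp add: hom swap_vars_braid)
  have d4: "(a - b) * h' = a * g' - b * ?s g'" unfolding h'_def by (rule S)
  have d5: "(a - c) * ?t h' = a * g' - c * ?t (?s g')"
    using arg_cong[OF d4, of ?t] by (simp add: hom tg')
  have d6: "(b - c) * dem (Suc i) h' = b * h' - c * ?t h'" by (rule T)
  have "V * dem (Suc i) h' = (a - c) * (a - b) * ((b - c) * dem (Suc i) h')"
    by (simp add: V_def mult_ac)
  also have "\<dots> = (a - c) * b * ((a - b) * h') - (a - b) * c * ((a - c) * ?t h')"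
    by (simp only: d6) (simp add: algebra_simps)
  also have "\<dots> = a * a * ((b - c) * g') - b * b * ((a - c) * ?s g') + c * c * ((a - b) * ?t (?s g'))"
    by (simp only: d4 d5) (simp add: algebra_simps)
  also have "\<dots> = R"
    by (simp only: d1 d2 d3 R_def) (simp add: algebra_simps)
  finally have 2: "V * dem (Suc i) (dem i (dem (Suc i) f)) = R" by (simp add: g'_def h'_def)

  have "V \<noteq> 0" by (simp add: V_def defs var_diff_nonzero del: right_minus_eq)
  with 1 2 show ?thesis by (metis mult_cancel_left)
qed


subsection \<open>Well-definedness of key polynomials\<close>

lemma swap_entries_weight_less:
  assumes "Poly_Mapping.lookup \<alpha> i < Poly_Mapping.lookup \<alpha> (Suc i)"
  defines "w \<equiv> \<lambda>\<beta> :: composition. \<Sum>k\<in>Poly_Mapping.keys \<beta>. k * Poly_Mapping.lookup \<beta> k"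
  shows "w (swap_entries i \<alpha>) < w \<alpha>"
proof -
  define K where "K = (Poly_Mapping.keys \<alpha> \<union> Poly_Mapping.keys (swap_entries i \<alpha>)) - {i, Suc i}"
  have w: "w \<beta> = (\<Sum>k\<in>K. k * Poly_Mapping.lookup \<beta> k) +
      (i * Poly_Mapping.lookup \<beta> i + Suc i * Poly_Mapping.lookup \<beta> (Suc i))"
    if "\<beta> \<in> {\<alpha>, swap_entries i \<alpha>}" for \<beta>
  proof -
    have "w \<beta> = (\<Sum>k\<in>K \<union> {i, Suc i}. k * Poly_Mapping.lookup \<beta> k)"
      unfolding w_def using that
      by (intro sum.mono_neutral_left) (auto simp: K_def in_keys_iff)
    also have "\<dots> = (\<Sum>k\<in>K. k * Poly_Mapping.lookup \<beta> k) +
        (\<Sum>k\<in>{i, Suc i}. k * Poly_Mapping.lookup \<beta> k)"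
      by (rule sum.union_disjoint) (auto simp: K_def)
    finally show ?thesis by simp
  qed
  have "(\<Sum>k\<in>K. k * Poly_Mapping.lookup (swap_entries i \<alpha>) k) =
      (\<Sum>k\<in>K. k * Poly_Mapping.lookup \<alpha> k)"
    by (rule sum.cong) (auto simp: K_def lookup_swap_entries transpose_def)
  thus ?thesis using assms(1) by (simp add: w lookup_swap_entries)
qed

lemma not_is_partition_iff:
  "\<not> is_partition \<alpha> \<longleftrightarrow> (\<exists>i. Poly_Mapping.lookup \<alpha> i < Poly_Mapping.lookup \<alpha> (Suc i))"
proof
  assume "\<not> is_partition \<alpha>"
  thus "\<exists>i. Poly_Mapping.lookup \<alpha> i < Poly_Mapping.lookup \<alpha> (Suc i)"
    unfolding is_partition_def
    by (metis antimonoI lift_Suc_antimono_le not_le)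
next
  assume "\<exists>i. Poly_Mapping.lookup \<alpha> i < Poly_Mapping.lookup \<alpha> (Suc i)"
  thus "\<not> is_partition \<alpha>"
    unfolding is_partition_def antimono_def by (meson le_SucI not_le order_refl)
qed

theorem ex1_is_key_poly: "\<exists>!p. is_key_poly \<alpha> p"
proof (induction "\<Sum>k\<in>Poly_Mapping.keys \<alpha>. k * Poly_Mapping.lookup \<alpha> k"
    arbitrary: \<alpha> rule: less_induct)
  case less
  have step: "\<exists>!p. is_key_poly (swap_entries i \<alpha>) p"
    if "Poly_Mapping.lookup \<alpha> i < Poly_Mapping.lookup \<alpha> (Suc i)" for i
    by (rule less) (rule swap_entries_weight_less[OF that])
  have step2: "\<exists>!p. is_key_poly (swap_entries j (swap_entries i \<alpha>)) p"
    if "Poly_Mapping.lookup \<alpha> i < Poly_Mapping.lookup \<alpha> (Suc i)"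
      "Poly_Mapping.lookup (swap_entries i \<alpha>) j < Poly_Mapping.lookup (swap_entries i \<alpha>) (Suc j)"
    for i j
    by (rule less) (rule less_trans[OF swap_entries_weight_less[OF that(2)]
          swap_entries_weight_less[OF that(1)]])
  have step3: "\<exists>!p. is_key_poly (swap_entries k (swap_entries j (swap_entries i \<alpha>))) p"
    if "Poly_Mapping.lookup \<alpha> i < Poly_Mapping.lookup \<alpha> (Suc i)"
      "Poly_Mapping.lookup (swap_entries i \<alpha>) j < Poly_Mapping.lookup (swap_entries i \<alpha>) (Suc j)"
      "Poly_Mapping.lookup (swap_entries j (swap_entries i \<alpha>)) k <
       Poly_Mapping.lookup (swap_entries j (swap_entries i \<alpha>)) (Suc k)"
    for i j k
    by (rule less) (rule less_trans[OF less_trans[OF swap_entries_weight_less[OF that(3)]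
          swap_entries_weight_less[OF that(2)]] swap_entries_weight_less[OF that(1)]])
  have confluent: "dem i p = dem j q"
    if "i < j"
      and i: "Poly_Mapping.lookup \<alpha> i < Poly_Mapping.lookup \<alpha> (Suc i)"
      and j: "Poly_Mapping.lookup \<alpha> j < Poly_Mapping.lookup \<alpha> (Suc j)"
      and p: "is_key_poly (swap_entries i \<alpha>) p" and q: "is_key_poly (swap_entries j \<alpha>) q"
    for i j p q
  proof (cases "j = Suc i")
    case True
    have ij: "Poly_Mapping.lookup (swap_entries i \<alpha>) j <
          Poly_Mapping.lookup (swap_entries i \<alpha>) (Suc j)"
      and iji: "Poly_Mapping.lookup (swap_entries j (swap_entries i \<alpha>)) i <
          Poly_Mapping.lookup (swap_entries j (swap_entries i \<alpha>)) (Suc i)"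
      and ji: "Poly_Mapping.lookup (swap_entries j \<alpha>) i <
          Poly_Mapping.lookup (swap_entries j \<alpha>) (Suc i)"
      and jij: "Poly_Mapping.lookup (swap_entries i (swap_entries j \<alpha>)) j <
          Poly_Mapping.lookup (swap_entries i (swap_entries j \<alpha>)) (Suc j)"
      using i j True by (auto simp: lookup_swap_entries transpose_def)
    obtain r where r: "is_key_poly (swap_entries i (swap_entries j (swap_entries i \<alpha>))) r"
      using step3[OF i ij iji] by blast
    hence r': "is_key_poly (swap_entries j (swap_entries i (swap_entries j \<alpha>))) r"
      using True swap_entries_braid by simp
    have "p = dem j (dem i r)"
      using step[OF i] p is_key_poly.ascent[OF ij is_key_poly.ascent[OF iji r]] by blast
    moreover have "q = dem i (dem j r)"
      using step[OF j] q is_key_poly.ascent[OF ji is_key_poly.ascent[OF jij r']] by blast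
    ultimately show ?thesis using True dem_braid by simp
  next
    case False
    hence far: "Suc i < j" using \<open>i < j\<close> by simp
    have ij: "Poly_Mapping.lookup (swap_entries i \<alpha>) j <
          Poly_Mapping.lookup (swap_entries i \<alpha>) (Suc j)"
      and ji: "Poly_Mapping.lookup (swap_entries j \<alpha>) i <
          Poly_Mapping.lookup (swap_entries j \<alpha>) (Suc i)"
      using i j far by (auto simp: lookup_swap_entries transpose_def)
    obtain r where r: "is_key_poly (swap_entries j (swap_entries i \<alpha>)) r"
      using step2[OF i ij] by blast
    hence r': "is_key_poly (swap_entries i (swap_entries j \<alpha>)) r"
      using swap_entries_commute[OF far] by simp
    have "p = dem j r" using step[OF i] p is_key_poly.ascent[OF ij r] by blast
    moreover have "q = dem i r" using step[OF j] q is_key_poly.ascent[OF ji r'] by blast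
    ultimately show ?thesis using dem_commute[OF far] by simp
  qed
  show ?case
  proof (cases "is_partition \<alpha>")
    case True
    have "p = Poly_Mapping.single \<alpha> 1" if "is_key_poly \<alpha> p" for p
      using that
    proof cases
      case (ascent i q)
      thus ?thesis using True not_is_partition_iff by blast
    qed
    thus ?thesis using is_key_poly.partition[OF True] by blast
  next
    case False
    then obtain i where i: "Poly_Mapping.lookup \<alpha> i < Poly_Mapping.lookup \<alpha> (Suc i)"
      using not_is_partition_iff by blast
    obtain p where p: "is_key_poly (swap_entries i \<alpha>) p" using step[OF i] by blast
    show ?thesis
    proof (rule ex1I)
      show "is_key_poly \<alpha> (dem i p)" by (rule is_key_poly.ascent[OF i p])
    next
      fix p' assume "is_key_poly \<alpha> p'"
      then obtain j q where j: "Poly_Mapping.lookup \<alpha> j < Poly_Mapping.lookup \<alpha> (Suc j)"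
        and q: "is_key_poly (swap_entries j \<alpha>) q" and p': "p' = dem j q"
        using False by (cases rule: is_key_poly.cases) auto
      show "p' = dem i p"
      proof (cases i j rule: linorder_cases)
        case less
        show ?thesis using confluent[OF less i j p q] p' by simp
      next
        case equal
        thus ?thesis using step[OF i] p q p' by blast
      next
        case greater
        show ?thesis using confluent[OF greater j i q p] p' by simp
      qed
    qed
  qed
qed

lemma is_key_poly_iff: "is_key_poly \<alpha> p \<longleftrightarrow> p = key_poly \<alpha>"
  unfolding key_poly_def using ex1_is_key_poly[of \<alpha>] by (metis the_equality)

theorem key_poly_partition: "is_partition \<alpha> \<Longrightarrow> key_poly \<alpha> = Poly_Mapping.single \<alpha> 1"
  using is_key_poly.partition is_key_poly_iff by metis

theorem key_poly_ascent:
  assumes "Poly_Mapping.lookup \<alpha> i < Poly_Mapping.lookup \<alpha> (Suc i)"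
  shows "key_poly \<alpha> = divided_difference i (var i * key_poly (swap_entries i \<alpha>))"
  using is_key_poly.ascent[OF assms] is_key_poly_iff by metis

end

theory Submission
  imports Defs
begin

text \<open>
  The idea is to peel off the last variable. For a composition \<open>xs @ [p]\<close> of length \<open>n + 1\<close> the key
  polynomial has an expansion
  \<open>\<kappa>(xs @ [p]) = z ^ w * \<kappa>(xs) + (\<Sum>(v, \<gamma>). z ^ v * \<kappa>(\<gamma>))\<close>
  in which \<open>z\<close> is the last variable and \<open>\<gamma>\<close> runs over a finite list of compositions of length
  \<open>n\<close>. All terms come with a plus sign, so at \<open>(1, \<dots>, 1)\<close> every extra term may be estimated by
  induction on the length: it contributes at least \<open>1\<close> plus the right-inversion sum of \<open>\<gamma>\<close>.
  Appending \<open>p\<close> to \<open>xs\<close> increases the right-inversion sum by \<open>\<Sum>x\<leftarrow>xs. p - x\<close> (truncated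
  subtraction), so it suffices that the extra terms together contribute at least that much. This
  is \<open>key_at_snoc_expansion\<close>, and \<open>eval_ones_key_at_ge\<close> draws the conclusion.

  The expansion for arbitrary \<open>xs\<close> follows from the one for weakly decreasing \<open>xs\<close>: the operators
  \<open>dem i\<close> that rearrange the entries of \<open>xs\<close> do not involve the last variable, they send a key
  polynomial to a key polynomial, and they never decrease its right-inversion sum, while
  \<open>\<Sum>x\<leftarrow>xs. p - x\<close> does not depend on the order of \<open>xs\<close>.

  For a weakly decreasing \<open>\<nu>\<close> with all entries at most \<open>p\<close> the expansion is completely explicit
  (\<open>key_at_branching\<close>). If \<open>\<lambda>\<close> is the partition \<open>p # \<nu>\<close>, there is one term for each \<open>\<mu>\<close> such that
  \<open>\<lambda>\<^sub>1 \<ge> \<mu>\<^sub>1 \<ge> \<lambda>\<^sub>2 \<ge> \<mu>\<^sub>2 \<ge> \<dots>\<close>, and \<open>\<gamma>\<close> is a certain rearrangement of \<open>\<mu>\<close>. Its proof is a recursion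
  that peels off the first variable, based on \<open>key_at_Cons_insert\<close>: when a composition has a single
  entry exceeding its first one, splitting off the first variable just lets this large entry slide
  down. The explicit form gives a recursion for the total contribution of the terms
  (\<open>strip_count_Cons\<close>) from which the required estimate is immediate (\<open>strip_count_ge\<close>).
\<close>

section \<open>Sorting lists by adjacent exchanges\<close>

text \<open>This is \<open>\<Sum>i. i * xs ! i\<close>, which drops when an ascent is exchanged.\<close>

primrec position_weight :: "nat list \<Rightarrow> nat" where
  "position_weight [] = 0"
| "position_weight (x # xs) = sum_list xs + position_weight xs"

lemma position_weight_swap_less:
  "a < b \<Longrightarrow> position_weight (us @ b # a # vs) < position_weight (us @ a # b # vs)"
  by (induction us) simp_all

lemma sorted_or_ascent_cases:
  fixes xs :: "nat list"
  obtains (sorted) "sorted_wrt (\<ge>) xs"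
  | (ascent) us a b vs where "xs = us @ a # b # vs" "a < b"
proof (cases "sorted_wrt (\<ge>) xs")
  case False
  hence "\<exists>i. Suc i < length xs \<and> xs ! i < xs ! Suc i"
    by (subst (asm) sorted_wrt_iff_nth_Suc_transp) (auto simp: not_le transp_def)
  then obtain i where i: "Suc i < length xs" "xs ! i < xs ! Suc i" by blast
  hence "xs = take i xs @ xs ! i # xs ! Suc i # drop (Suc (Suc i)) xs"
    by (simp add: Cons_nth_drop_Suc)
  with i(2) that(2) show ?thesis by blast
qed (use that in blast)

text \<open>
  Induction along the recursion for key polynomials: partitions first, then one ascent at a time.
\<close>

lemma adjacent_swap_induct [case_names sorted ascent]:
  fixes xs :: "nat list"
  assumes sorted: "\<And>xs. sorted_wrt (\<ge>) xs \<Longrightarrow> P xs"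
    and step: "\<And>us a b vs. a < b \<Longrightarrow> P (us @ b # a # vs) \<Longrightarrow> P (us @ a # b # vs)"
  shows "P xs"
proof (induction "position_weight xs" arbitrary: xs rule: less_induct)
  case less
  show ?case
  proof (cases xs rule: sorted_or_ascent_cases)
    case sorted
    thus ?thesis by (rule assms(1))
  next
    case (ascent us a b vs)
    with less step position_weight_swap_less show ?thesis by metis
  qed
qed

section \<open>Demazure operators\<close>

lemma swap_vars_zero [simp]: "swap_vars i 0 = 0"
  by (rule poly_mapping_eqI) (simp add: lookup_swap_vars)

lemma swap_vars_one [simp]: "swap_vars i 1 = 1"
  by (simp add: swap_vars_single flip: single_one)

lemma swap_vars_power: "swap_vars i (f ^ n) = swap_vars i f ^ n"
  by (induction n) (simp_all add: swap_vars_mult)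

lemma dem_eqI:
  assumes "(var i - var (Suc i)) * g = var i * f - var (Suc i) * swap_vars i f"
  shows "dem i f = g"
  using assms
  by (intro divided_difference_unique) (simp add: swap_vars_mult swap_vars_var mult.commute)

lemma dem_add: "dem i (f + g) = dem i f + dem i g"
  by (rule dem_eqI) (simp only: distrib_left dem_mult swap_vars_add, simp add: algebra_simps)

lemma dem_zero [simp]: "dem i 0 = 0"
  by (rule dem_eqI) simp

lemma dem_sum: "dem i (sum f A) = (\<Sum>x\<in>A. dem i (f x))"
  by (induction A rule: infinite_finite_induct) (simp_all add: dem_add dem_zero del: mult_zero_right)

lemma dem_sum_list: "dem i (sum_list (map f xs)) = (\<Sum>x\<leftarrow>xs. dem i (f x))"
  by (induction xs) (simp_all add: dem_add dem_zero del: mult_zero_right)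

lemma dem_mult_invariant: "swap_vars i g = g \<Longrightarrow> dem i (g * f) = g * dem i f"
  by (rule dem_eqI, subst mult.left_commute, subst dem_mult) (simp add: swap_vars_mult algebra_simps)

lemma dem_invariant: "swap_vars i f = f \<Longrightarrow> dem i f = f"
  by (rule dem_eqI) (simp add: algebra_simps)

lemma dem_dem: "dem i (dem i f) = dem i f"
  by (rule dem_invariant) (rule swap_vars_dem)

lemma dem_two_powers:
  assumes "b \<le> a"
  shows "dem i (var i ^ a * var (Suc i) ^ b) = (\<Sum>t=b..a. var i ^ (a + b - t) * var (Suc i) ^ t)"
proof (rule dem_eqI)
  define x y where "x = var i" and "y = var (Suc i)"
  have "(x - y) * (\<Sum>t=b..a. x ^ (a + b - t) * y ^ t) = x ^ Suc a * y ^ b - x ^ b * y ^ Suc a"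
    using assms
  proof (induction a rule: dec_induct)
    case base
    show ?case by (simp add: algebra_simps)
  next
    case (step a)
    have "(\<Sum>t=b..Suc a. x ^ (Suc a + b - t) * y ^ t) =
        (\<Sum>t=b..a. x * (x ^ (a + b - t) * y ^ t)) + x ^ b * y ^ Suc a"
      using step by (simp add: Suc_diff_le mult.assoc)
    also have "\<dots> = x * (\<Sum>t=b..a. x ^ (a + b - t) * y ^ t) + x ^ b * y ^ Suc a"
      by (simp add: sum_distrib_left)
    finally have "(x - y) * (\<Sum>t=b..Suc a. x ^ (Suc a + b - t) * y ^ t) =
        x * ((x - y) * (\<Sum>t=b..a. x ^ (a + b - t) * y ^ t)) + (x - y) * (x ^ b * y ^ Suc a)"
      by (simp add: algebra_simps)
    thus ?case by (simp only: step.IH) (simp add: algebra_simps)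
  qed
  thus "(var i - var (Suc i)) * (\<Sum>t=b..a. var i ^ (a + b - t) * var (Suc i) ^ t) =
      var i * (var i ^ a * var (Suc i) ^ b) -
      var (Suc i) * swap_vars i (var i ^ a * var (Suc i) ^ b)"
    by (simp add: x_def y_def swap_vars_mult swap_vars_power swap_vars_var algebra_simps)
qed

section \<open>Key polynomials of lists in shifted variables\<close>

fun monom_at :: "nat \<Rightarrow> nat list \<Rightarrow> mpoly" where
  "monom_at k [] = 1"
| "monom_at k (x # xs) = var k ^ x * monom_at (Suc k) xs"

lemma monom_at_append: "monom_at k (xs @ ys) = monom_at k xs * monom_at (k + length xs) ys"
  by (induction xs arbitrary: k) (simp_all add: mult.assoc)

lemma swap_vars_monom_at: "Suc i < k \<or> k + length xs \<le> i \<Longrightarrow> swap_vars i (monom_at k xs) = monom_at k xs"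
  by (induction xs arbitrary: k)
    (auto simp: swap_vars_mult swap_vars_power swap_vars_var transpose_def)

lemma var_power: "var i ^ n = Poly_Mapping.single (Poly_Mapping.single i n) 1"
  by (induction n) (simp_all add: var_def mult_single flip: single_add)

lemma monom_at_nonzero: "monom_at k xs \<noteq> 0"
proof -
  have "var i \<noteq> 0" for i
    by (metis var_def lookup_single_eq lookup_zero zero_neq_one)
  thus ?thesis by (induction xs arbitrary: k) auto
qed

lemma monom_at_0: "monom_at 0 xs = Poly_Mapping.single (Poly_Mapping.nth xs) 1"
proof (induction xs rule: rev_induct)
  case (snoc x xs)
  have "Poly_Mapping.nth (xs @ [x]) = Poly_Mapping.nth xs + Poly_Mapping.single (length xs) x"
    by (rule poly_mapping_eqI)
      (auto simp: nth.rep_eq lookup_add lookup_single when_def nth_default_append nth_default_def nth_append)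
  with snoc show ?case by (simp add: monom_at_append var_power mult_single)
next
  case Nil
  have "Poly_Mapping.nth ([] :: nat list) = 0"
    by (rule poly_mapping_eqI) (simp add: nth.rep_eq)
  thus ?case by simp
qed

lemma is_partition_nth: "sorted_wrt (\<ge>) xs \<Longrightarrow> is_partition (Poly_Mapping.nth xs)"
  unfolding is_partition_def
  by (rule antimonoI)
    (auto simp: nth.rep_eq nth_default_def sorted_wrt_iff_nth_less le_less)

lemma swap_entries_nth:
  "swap_entries (length us) (Poly_Mapping.nth (us @ a # b # vs)) = Poly_Mapping.nth (us @ b # a # vs)"
  by (rule poly_mapping_eqI)
    (auto simp: lookup_swap_entries nth.rep_eq transpose_def nth_default_append nth_default_Cons
      Suc_diff_le split: nat.split)

text \<open>
  The recursion for key polynomials, run in the variables with indices \<open>k, k + 1, \<dots>\<close>. The offset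
  makes it possible to split off the first variable and continue with the remaining ones.
\<close>

inductive is_key_at :: "nat \<Rightarrow> nat list \<Rightarrow> mpoly \<Rightarrow> bool" for k where
  sorted: "sorted_wrt (\<ge>) xs \<Longrightarrow> is_key_at k xs (monom_at k xs)"
| ascent: "a < b \<Longrightarrow> is_key_at k (us @ b # a # vs) p \<Longrightarrow>
    is_key_at k (us @ a # b # vs) (dem (k + length us) p)"

text \<open>
  Prefixing \<open>k\<close> entries that are at least as large as all others multiplies by a monomial in
  \<open>k\<close> variables that the operators in use do not see. As polynomials have no zero divisors, the
  recursion with offset inherits its independence of choices from \<open>key_poly\<close>.
\<close>

lemma is_key_at_imp_key_poly:
  assumes "is_key_at k xs p" "\<forall>x\<in>set xs. x \<le> N"
  shows "key_poly (Poly_Mapping.nth (replicate k N @ xs)) = monom_at 0 (replicate k N) * p"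
  using assms
proof (induction rule: is_key_at.induct)
  case (sorted xs)
  moreover have "sorted_wrt (\<ge>) (replicate k N)"
    by (induction k) auto
  ultimately have "sorted_wrt (\<ge>) (replicate k N @ xs)"
    by (auto simp: sorted_wrt_append)
  hence "key_poly (Poly_Mapping.nth (replicate k N @ xs)) = monom_at 0 (replicate k N @ xs)"
    by (simp only: monom_at_0 key_poly_partition is_partition_nth)
  thus ?case by (simp add: monom_at_append)
next
  case (ascent a b us vs p)
  let ?us = "replicate k N @ us"
  have "Poly_Mapping.lookup (Poly_Mapping.nth (?us @ a # b # vs)) (length ?us) <
      Poly_Mapping.lookup (Poly_Mapping.nth (?us @ a # b # vs)) (Suc (length ?us))"
    using \<open>a < b\<close> by (simp add: nth.rep_eq nth_default_append nth_default_Cons)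
  from key_poly_ascent[OF this] ascent
  show ?case
    by (simp add: swap_entries_nth[of ?us, simplified] dem_mult_invariant swap_vars_monom_at)
qed

lemma is_key_at_unique: "is_key_at k xs p \<Longrightarrow> is_key_at k xs q \<Longrightarrow> p = q"
  using is_key_at_imp_key_poly[of k xs p "Max (set xs)"] is_key_at_imp_key_poly[of k xs q "Max (set xs)"]
    monom_at_nonzero by simp

definition key_at :: "nat \<Rightarrow> nat list \<Rightarrow> mpoly" where
  "key_at k xs = (THE p. is_key_at k xs p)"

lemma is_key_at_iff: "is_key_at k xs p \<longleftrightarrow> p = key_at k xs"
proof -
  have "\<exists>p. is_key_at k xs p"
    by (induction xs rule: adjacent_swap_induct) (blast intro: is_key_at.intros)+
  thus ?thesis unfolding key_at_def by (metis is_key_at_unique the_equality)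
qed

lemma key_at_0: "key_at 0 xs = key_poly (Poly_Mapping.nth xs)"
  using is_key_at_imp_key_poly[of 0 xs _ "Max (set xs)"] is_key_at_iff by simp

lemma key_at_sorted: "sorted_wrt (\<ge>) xs \<Longrightarrow> key_at k xs = monom_at k xs"
  using is_key_at.sorted is_key_at_iff by metis

lemma key_at_ascent_less:
  "a < b \<Longrightarrow> key_at k (us @ a # b # vs) = dem (k + length us) (key_at k (us @ b # a # vs))"
  using is_key_at.ascent is_key_at_iff by metis


text \<open>
  Two equal adjacent entries make the key polynomial symmetric in the corresponding variables. For a
  monomial this is plain. Otherwise there is an ascent, and \<open>dem\<close> at the ascent either commutes with
  \<open>dem\<close> at the equal entries, or overlaps with it; in the latter case the two entries that
  form the pair can be moved together past the third one, and the braid relation applies.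
\<close>

lemma key_at_symmetric: "dem (k + length us) (key_at k (us @ a # a # vs)) = key_at k (us @ a # a # vs)"
proof -
  have "dem (k + i) (key_at k xs) = key_at k xs" if "Suc i < length xs" "xs ! i = xs ! Suc i" for xs i
    using that
  proof (induction "position_weight xs" arbitrary: xs i rule: less_induct)
    case less
    show ?case
    proof (cases xs rule: sorted_or_ascent_cases)
      case sorted
      have "xs = take i xs @ xs ! i # xs ! Suc i # drop (Suc (Suc i)) xs"
        using less.prems(1) by (simp add: Cons_nth_drop_Suc)
      then obtain us x vs where xs: "xs = us @ x # x # vs" "length us = i"
        using less.prems by (metis Suc_lessD length_take min.absorb4)
      show ?thesis unfolding key_at_sorted[OF sorted] unfolding xs(1)
        by (rule dem_invariant)
          (simp add: monom_at_append swap_vars_mult swap_vars_monom_at swap_vars_power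
            swap_vars_var \<open>length us = i\<close> algebra_simps)
    next
      case (ascent us a b vs)
      let ?ys = "us @ b # a # vs"
      define j where "j = length us"
      have key: "key_at k xs = dem (k + j) (key_at k ?ys)"
        unfolding j_def ascent(1) by (rule key_at_ascent_less[OF \<open>a < b\<close>])
      have ys: "position_weight ?ys < position_weight xs"
        unfolding ascent(1) by (rule position_weight_swap_less[OF \<open>a < b\<close>])
      have "i \<noteq> j" using less.prems ascent by (auto simp: j_def nth_append)
      then consider (left) "Suc i < j" | (adjacent_left) "j = Suc i" | (adjacent_right) "i = Suc j"
        | (right) "Suc j < i" by linarith
      thus ?thesis
      proof cases
        case left
        hence "dem (k + i) (key_at k ?ys) = key_at k ?ys"
          using less.prems ascent by (intro less.hyps ys) (auto simp: j_def nth_append)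
        thus ?thesis unfolding key using left dem_commute[of "k + i" "k + j"] by simp
      next
        case right
        hence "dem (k + i) (key_at k ?ys) = key_at k ?ys"
          using less.prems ascent
          by (intro less.hyps ys) (auto simp: j_def nth_append nth_Cons' split: if_splits)
        moreover have "dem (k + i) (key_at k xs) = dem (k + j) (dem (k + i) (key_at k ?ys))"
          unfolding key using right dem_commute[of "k + j" "k + i"] by simp
        ultimately show ?thesis unfolding key by simp
      next
        case adjacent_left
        then obtain us' where us: "us = us' @ [a]" "length us' = i"
          using less.prems ascent by (cases us rule: rev_cases) (auto simp: j_def nth_append)
        let ?zs = "us' @ b # a # a # vs"
        have "position_weight ?zs < position_weight xs"
          using position_weight_swap_less[OF \<open>a < b\<close>, of us' "a # vs"] ys by (simp add: us)
        hence "dem (k + j) (key_at k ?zs) = key_at k ?zs"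
          using us adjacent_left by (intro less.hyps) (auto simp: nth_append)
        moreover have "key_at k ?ys = dem (k + i) (key_at k ?zs)"
          using key_at_ascent_less[OF \<open>a < b\<close>, of k us' "a # vs"] us by simp
        ultimately show ?thesis
          unfolding key adjacent_left by (simp add: dem_braid)
      next
        case adjacent_right
        then obtain vs' where vs: "vs = b # vs'"
          using less.prems ascent by (cases vs) (auto simp: j_def nth_append)
        let ?zs = "us @ b # b # a # vs'"
        have "position_weight ?zs < position_weight xs"
          using position_weight_swap_less[OF \<open>a < b\<close>, of "us @ [b]" vs'] ys by (simp add: vs)
        hence "dem (k + j) (key_at k ?zs) = key_at k ?zs"
          by (intro less.hyps) (auto simp: j_def nth_append)
        moreover have "key_at k ?ys = dem (k + i) (key_at k ?zs)"
          using key_at_ascent_less[OF \<open>a < b\<close>, of k "us @ [b]" vs'] vs adjacent_right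
          by (simp add: j_def)
        ultimately show ?thesis
          unfolding key adjacent_right by (simp flip: dem_braid)
      qed
    qed
  qed
  from this[of "length us" "us @ a # a # vs"] show ?thesis by (simp add: nth_append)
qed

lemma key_at_ascent:
  "a \<le> b \<Longrightarrow> key_at k (us @ a # b # vs) = dem (k + length us) (key_at k (us @ b # a # vs))"
  using key_at_ascent_less key_at_symmetric by (cases "a = b") auto

lemma dem_key_at_ascent:
  "a \<le> b \<Longrightarrow> dem (k + length us) (key_at k (us @ a # b # vs)) = key_at k (us @ a # b # vs)"
  using key_at_ascent dem_dem by metis

lemma key_at_Cons:
  assumes "\<forall>x\<in>set xs. x \<le> a"
  shows "key_at k (a # xs) = var k ^ a * key_at (Suc k) xs"
  using assms
proof (induction xs rule: adjacent_swap_induct)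
  case (sorted xs)
  thus ?case by (simp add: key_at_sorted)
next
  case (ascent us c b vs)
  have "key_at k (a # us @ c # b # vs) = dem (k + length (a # us)) (key_at k (a # us @ b # c # vs))"
    using key_at_ascent_less[OF \<open>c < b\<close>, of k "a # us"] by simp
  also have "\<dots> = dem (k + length (a # us)) (var k ^ a * key_at (Suc k) (us @ b # c # vs))"
    using ascent by simp
  also have "\<dots> = var k ^ a * dem (Suc k + length us) (key_at (Suc k) (us @ b # c # vs))"
    by (subst dem_mult_invariant) (simp_all add: swap_vars_power swap_vars_var transpose_def)
  finally show ?case using key_at_ascent_less[OF \<open>c < b\<close>, of "Suc k" us] by simp
qed

text \<open>
  The rule behind all branching. If both \<open>c\<close> and \<open>d\<close> are empty, this is the action of \<open>dem\<close> on a
  monomial in two variables. Everything else is a rearrangement of the entries after the first one, and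
  because \<open>b\<close> stays at least as large as the entries of \<open>c\<close> and \<open>d\<close>, the same operators perform it
  for all \<open>b\<close> at once. For \<open>b = r\<close> there may be ties with \<open>c\<close>, which is where the
  symmetry at equal entries enters.
\<close>

lemma key_at_Cons_insert:
  assumes "r \<le> a" "\<forall>x\<in>set (c @ d). x \<le> r"
  shows "key_at k (r # c @ a # d) =
    (\<Sum>b=r..a. var k ^ (a + r - b) * key_at (Suc k) (c @ b # d))"
  using assms(2)
proof (induction c arbitrary: d rule: rev_induct)
  case Nil
  hence "\<forall>x\<in>set d. x \<le> r" by simp
  thus ?case
  proof (induction d rule: adjacent_swap_induct)
    case (sorted d)
    have "key_at k (r # a # d) = dem k (monom_at k (a # r # d))"
      using key_at_ascent[OF \<open>r \<le> a\<close>, of k "[]" d] sorted \<open>r \<le> a\<close>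
      by (subst (asm) key_at_sorted) auto
    also have "\<dots> = dem k (monom_at (Suc (Suc k)) d * (var k ^ a * var (Suc k) ^ r))"
      by (simp add: mult_ac)
    also have "\<dots> = monom_at (Suc (Suc k)) d * (\<Sum>b=r..a. var k ^ (a + r - b) * var (Suc k) ^ b)"
      by (simp only: dem_mult_invariant[OF swap_vars_monom_at] dem_two_powers[OF \<open>r \<le> a\<close>] lessI simp_thms)
    also have "\<dots> = (\<Sum>b=r..a. var k ^ (a + r - b) * key_at (Suc k) (b # d))"
      unfolding sum_distrib_left
    proof (rule sum.cong)
      fix b assume "b \<in> {r..a}"
      hence "sorted_wrt (\<ge>) (b # d)" using sorted by auto
      thus "monom_at (Suc (Suc k)) d * (var k ^ (a + r - b) * var (Suc k) ^ b) =
          var k ^ (a + r - b) * key_at (Suc k) (b # d)"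
        by (simp add: key_at_sorted mult_ac del: sorted_wrt.simps)
    qed simp
    finally show ?case by simp
  next
    case (ascent us x y vs)
    let ?dem = "dem (Suc (Suc k) + length us)"
    have "key_at k (r # a # us @ x # y # vs) = ?dem (key_at k (r # a # us @ y # x # vs))"
      using key_at_ascent_less[OF \<open>x < y\<close>, of k "r # a # us"] by simp
    also have "\<dots> = (\<Sum>b=r..a. ?dem (var k ^ (a + r - b) * key_at (Suc k) (b # us @ y # x # vs)))"
      using ascent by (simp add: dem_sum)
    also have "\<dots> = (\<Sum>b=r..a. var k ^ (a + r - b) * key_at (Suc k) (b # us @ x # y # vs))"
    proof (rule sum.cong)
      fix b
      show "?dem (var k ^ (a + r - b) * key_at (Suc k) (b # us @ y # x # vs)) =
          var k ^ (a + r - b) * key_at (Suc k) (b # us @ x # y # vs)"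
        using key_at_ascent_less[OF \<open>x < y\<close>, of "Suc k" "b # us"]
        by (simp add: dem_mult_invariant swap_vars_power swap_vars_var transpose_def)
    qed simp
    finally show ?case by simp
  qed
next
  case (snoc x c)
  let ?dem = "dem (Suc k + length c)"
  have "x \<le> r" using snoc.prems by simp
  have "key_at k (r # (c @ [x]) @ a # d) = ?dem (key_at k (r # c @ a # x # d))"
    using key_at_ascent[of x a k "r # c" d] \<open>x \<le> r\<close> \<open>r \<le> a\<close> by simp
  also have "\<dots> = (\<Sum>b=r..a. ?dem (var k ^ (a + r - b) * key_at (Suc k) (c @ b # x # d)))"
    using snoc by (simp add: dem_sum)
  also have "\<dots> = (\<Sum>b=r..a. var k ^ (a + r - b) * key_at (Suc k) (c @ x # b # d))"
  proof (rule sum.cong)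
    fix b assume "b \<in> {r..a}"
    thus "?dem (var k ^ (a + r - b) * key_at (Suc k) (c @ b # x # d)) =
        var k ^ (a + r - b) * key_at (Suc k) (c @ x # b # d)"
      using key_at_ascent[of x b "Suc k" c d] \<open>x \<le> r\<close>
      by (simp add: dem_mult_invariant swap_vars_power swap_vars_var transpose_def)
  qed simp
  finally show ?case by simp
qed


section \<open>Branching from a partition followed by a large entry\<close>

text \<open>
  For a weakly decreasing \<open>\<nu>\<close> of length \<open>m\<close> and \<open>a \<ge> hd \<nu>\<close>, the lists \<open>c @ a # d\<close> with \<open>(w, c, d)\<close> in
  \<open>strip_contexts \<nu>\<close> are rearrangements of the sequences \<open>\<mu>\<close> with
  \<open>\<mu>\<^sub>1 = a \<ge> \<nu>\<^sub>1 \<ge> \<mu>\<^sub>2 \<ge> \<nu>\<^sub>2 \<ge> \<dots> \<ge> \<mu>\<^sub>m \<ge> \<nu>\<^sub>m\<close>, and \<open>w = sum_list \<nu> - sum_list (c @ d)\<close> is the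
  corresponding exponent of the last variable. The entry \<open>a\<close> is carried from left to right. If
  \<open>\<mu>\<^sub>2 = \<nu>\<^sub>1 = r\<close>, then \<open>r\<close> is put down and \<open>a\<close> carried on; if \<open>\<mu>\<^sub>2 = b < r\<close>, then \<open>a\<close> is put down
  and \<open>b\<close> carried on. The place of \<open>a\<close> does not depend on its size, so one context serves for all \<open>a\<close>.
\<close>

fun strip_contexts :: "nat list \<Rightarrow> (nat \<times> nat list \<times> nat list) list" where
  "strip_contexts [] = []"
| "strip_contexts [r] = [(r, [], [])]"
| "strip_contexts (r # s # \<nu>) =
     map (\<lambda>(w, c, d). (w, r # c, d)) (strip_contexts (s # \<nu>)) @
     concat (map (\<lambda>b. map (\<lambda>(w, c, d). (r - b + w, [], c @ b # d)) (strip_contexts (s # \<nu>))) [s..<r])"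

lemma strip_contexts_Cons_cases [consumes 1, case_names keep new]:
  assumes "(w, c, d) \<in> set (strip_contexts (r # s # \<nu>))"
  obtains c' where "(w, c', d) \<in> set (strip_contexts (s # \<nu>))" "c = r # c'"
  | w' b c' d' where "(w', c', d') \<in> set (strip_contexts (s # \<nu>))" "s \<le> b" "b < r"
      "w = r - b + w'" "c = []" "d = c' @ b # d'"
  using assms by auto

lemma strip_contexts_length:
  "(w, c, d) \<in> set (strip_contexts \<nu>) \<Longrightarrow> Suc (length c + length d) = length \<nu>"
proof (induction \<nu> arbitrary: w c d rule: strip_contexts.induct)
  case (3 r s \<nu>)
  from 3(3) show ?case
  proof (cases rule: strip_contexts_Cons_cases)
    case keep
    with 3(1) show ?thesis by force
  next
    case new
    with 3(1) show ?thesis by force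
  qed
qed auto

lemma strip_contexts_le:
  assumes "sorted_wrt (\<ge>) \<nu>" "(w, c, d) \<in> set (strip_contexts \<nu>)"
  shows "\<forall>x\<in>set (c @ d). x \<le> hd \<nu>"
  using assms
proof (induction \<nu> arbitrary: w c d rule: strip_contexts.induct)
  case (3 r s \<nu>)
  have IH: "\<forall>x\<in>set (c' @ d'). x \<le> r" if "(w', c', d') \<in> set (strip_contexts (s # \<nu>))" for w' c' d'
    using "3.IH"(1)[OF _ that] "3.prems"(1) by fastforce
  from 3(4) show ?case
  proof (cases rule: strip_contexts_Cons_cases)
    case (keep c')
    with IH[OF keep(1)] show ?thesis by simp
  next
    case (new w' b c' d')
    with IH[OF new(1)] show ?thesis by simp
  qed
qed auto

text \<open>
  The choice \<open>\<mu> = \<nu>\<close> contributes the key polynomial of \<open>\<nu>\<close> itself.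
\<close>

lemma strip_contexts_top:
  assumes "sorted_wrt (\<ge>) \<nu>" "\<nu> \<noteq> []"
  shows "\<exists>w c d. (w, c, d) \<in> set (strip_contexts \<nu>) \<and> c @ hd \<nu> # d = \<nu>"
  using assms
proof (induction \<nu> rule: strip_contexts.induct)
  case (3 r s \<nu>)
  then obtain w c d where wcd: "(w, c, d) \<in> set (strip_contexts (s # \<nu>))" "c @ s # d = s # \<nu>"
    by auto
  show ?case
  proof (cases "s = r")
    case True
    hence "(w, r # c, d) \<in> set (strip_contexts (r # s # \<nu>))" using wcd(1) by force
    thus ?thesis using wcd(2) True by (intro exI[of _ w] exI[of _ "r # c"] exI[of _ d]) simp
  next
    case False
    hence "s < r" using 3 by simp
    hence "(r - s + w, [], c @ s # d) \<in> set (strip_contexts (r # s # \<nu>))" using wcd(1) by force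
    thus ?thesis using wcd(2) by (metis append_Nil list.sel(1))
  qed
qed auto

lemma sum_triangle_swap:
  fixes f :: "nat \<Rightarrow> nat \<Rightarrow> 'a :: comm_monoid_add"
  shows "(\<Sum>b=r..p. \<Sum>a=r..b. f b a) = (\<Sum>a=r..p. \<Sum>b=a..p. f b a)"
  unfolding sum.Sigma[OF finite_atLeastAtMost ballI[OF finite_atLeastAtMost]]
  by (rule sum.reindex_bij_witness[where i = prod.swap and j = prod.swap]) auto

lemma sum_triangle_split:
  fixes f :: "nat \<Rightarrow> nat \<Rightarrow> 'a :: comm_monoid_add"
  assumes "s \<le> r"
  shows "(\<Sum>b=r..p. \<Sum>a=s..b. f b a) = (\<Sum>b=r..p. \<Sum>a=s..<r. f b a) + (\<Sum>a=r..p. \<Sum>b=a..p. f b a)"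
proof -
  have "(\<Sum>a=s..b. f b a) = (\<Sum>a=s..<r. f b a) + (\<Sum>a=r..b. f b a)" if "b \<in> {r..p}" for b
  proof -
    have "{s..b} = {s..<r} \<union> {r..b}" using that assms by auto
    moreover have "{s..<r} \<inter> {r..b} = {}" by auto
    ultimately show ?thesis by (simp add: sum.union_disjoint)
  qed
  moreover have "(\<Sum>b=r..p. \<Sum>a=r..b. f b a) = (\<Sum>a=r..p. \<Sum>b=a..p. f b a)"
    by (rule sum_triangle_swap)
  ultimately show ?thesis by (simp add: sum.distrib)
qed

lemma sum_list_concat_map: "sum_list (concat xss) = sum_list (map sum_list xss)"
  by (induction xss) simp_all

definition strip_sum :: "nat \<Rightarrow> nat \<Rightarrow> nat list \<Rightarrow> mpoly" where
  "strip_sum k a \<nu> = (\<Sum>(w, c, d)\<leftarrow>strip_contexts \<nu>. var (k + length \<nu>) ^ w * key_at k (c @ a # d))"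

text \<open>
  For the contexts that put \<open>r\<close> down first, \<open>key_at_Cons_insert\<close> splits off the first variable.
  For the others the first entry \<open>a\<close> is maximal, so its variable factors out.
\<close>

lemma strip_sum_Cons:
  assumes sorted: "sorted_wrt (\<ge>) (r # s # \<nu>)" and "r \<le> a"
  shows "strip_sum k a (r # s # \<nu>) =
    (\<Sum>b=r..a. var k ^ (a + r - b) * strip_sum (Suc k) b (s # \<nu>)) +
    (\<Sum>b=s..<r. var (k + length (r # s # \<nu>)) ^ (r - b) * var k ^ a * strip_sum (Suc k) b (s # \<nu>))"
proof -
  define C where "C = strip_contexts (s # \<nu>)"
  define z where "z = var (k + length (r # s # \<nu>))"
  have le: "\<forall>x\<in>set (c @ d). x \<le> r" if "(w, c, d) \<in> set C" for w c d
    using strip_contexts_le[of "s # \<nu>" w c d] that sorted unfolding C_def by fastforce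
  have H: "strip_sum (Suc k) b (s # \<nu>) = (\<Sum>(w, c, d)\<leftarrow>C. z ^ w * key_at (Suc k) (c @ b # d))" for b
    by (simp add: strip_sum_def C_def z_def)
  have "(\<Sum>(w, c, d)\<leftarrow>C. z ^ w * key_at k (r # c @ a # d)) =
      (\<Sum>(w, c, d)\<leftarrow>C. \<Sum>b=r..a. var k ^ (a + r - b) * (z ^ w * key_at (Suc k) (c @ b # d)))"
    using le by (intro arg_cong[of _ _ sum_list] map_cong refl)
      (auto simp: key_at_Cons_insert[OF \<open>r \<le> a\<close>] sum_distrib_left mult_ac)
  also have "\<dots> = (\<Sum>b=r..a. var k ^ (a + r - b) * strip_sum (Suc k) b (s # \<nu>))"
    unfolding H by (simp add: sum_list_sum_nth sum.swap[of _ "{r..a}"] split_beta sum_distrib_left)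
  finally have 1: "(\<Sum>(w, c, d)\<leftarrow>C. z ^ w * key_at k (r # c @ a # d)) = \<dots>" .
  have 2: "(\<Sum>(w, c, d)\<leftarrow>C. z ^ (r - b + w) * key_at k (a # c @ b # d)) =
      z ^ (r - b) * var k ^ a * strip_sum (Suc k) b (s # \<nu>)" if "b < r" for b
  proof -
    have "key_at k (a # c @ b # d) = var k ^ a * key_at (Suc k) (c @ b # d)"
      if "(w, c, d) \<in> set C" for w c d
      using le[OF that] \<open>r \<le> a\<close> \<open>b < r\<close> by (intro key_at_Cons) (auto intro: order.trans[OF _ \<open>r \<le> a\<close>])
    hence "(\<Sum>(w, c, d)\<leftarrow>C. z ^ (r - b + w) * key_at k (a # c @ b # d)) =
        (\<Sum>(w, c, d)\<leftarrow>C. z ^ (r - b) * var k ^ a * (z ^ w * key_at (Suc k) (c @ b # d)))"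
      by (intro arg_cong[of _ _ sum_list] map_cong refl) (auto simp: power_add mult_ac)
    thus ?thesis unfolding H case_prod_unfold by (simp add: sum_list_const_mult mult.assoc)
  qed
  have "strip_sum k a (r # s # \<nu>) =
      (\<Sum>(w, c, d)\<leftarrow>C. z ^ w * key_at k (r # c @ a # d)) +
      (\<Sum>b\<leftarrow>[s..<r]. \<Sum>(w, c, d)\<leftarrow>C. z ^ (r - b + w) * key_at k (a # c @ b # d))"
    unfolding strip_sum_def z_def[symmetric] strip_contexts.simps C_def[symmetric]
    by (simp add: map_concat sum_list_concat_map o_def case_prod_unfold)
  also have "(\<Sum>b\<leftarrow>[s..<r]. \<Sum>(w, c, d)\<leftarrow>C. z ^ (r - b + w) * key_at k (a # c @ b # d)) =
      (\<Sum>b=s..<r. z ^ (r - b) * var k ^ a * strip_sum (Suc k) b (s # \<nu>))"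
    unfolding interv_sum_list_conv_sum_set_nat set_upt using 2 by (intro sum.cong) auto
  finally show ?thesis unfolding 1 unfolding z_def .
qed

text \<open>
  Splitting off the first variable by \<open>key_at_Cons_insert\<close> and applying the induction hypothesis to
  the rest gives a sum over \<open>r \<le> b \<le> p\<close> and \<open>s \<le> a \<le> b\<close>. The part with \<open>a < r\<close> and the part with
  \<open>a \<ge> r\<close> match the second and the first sum in \<open>strip_sum_Cons\<close>, respectively, after reindexing.
\<close>

theorem key_at_branching:
  assumes "sorted_wrt (\<ge>) \<nu>" "\<nu> \<noteq> []" "hd \<nu> \<le> p"
  shows "key_at k (\<nu> @ [p]) = (\<Sum>a=hd \<nu>..p. var (k + length \<nu>) ^ (p - a) * strip_sum k a \<nu>)"
  using assms
proof (induction \<nu> arbitrary: k p rule: strip_contexts.induct)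
  case (2 r)
  have "key_at k ([r] @ [p]) = (\<Sum>b=r..p. var k ^ (p + r - b) * key_at (Suc k) [b])"
    using key_at_Cons_insert[of r p "[]" "[]" k] 2 by simp
  also have "\<dots> = (\<Sum>b=r..p. var k ^ (p + r - b) * var (Suc k) ^ b)"
    by (simp add: key_at_sorted)
  also have "\<dots> = (\<Sum>a=r..p. var k ^ a * var (Suc k) ^ (p + r - a))"
    by (rule sum.reindex_bij_witness[where i = "\<lambda>b. p + r - b" and j = "\<lambda>b. p + r - b"]) auto
  also have "\<dots> = (\<Sum>a=r..p. var (Suc k) ^ (p - a) * (var (Suc k) ^ r * var k ^ a))"
    by (rule sum.cong) (auto simp: mult_ac add.commute simp flip: power_add)
  finally show ?case by (simp add: strip_sum_def key_at_sorted)
next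
  case (3 r s \<nu>)
  define x z where "x = var k" and "z = var (k + length (r # s # \<nu>))"
  define h where "h = (\<lambda>b. strip_sum (Suc k) b (s # \<nu>))"
  have "s \<le> r" "r \<le> p" and sorted: "sorted_wrt (\<ge>) (s # \<nu>)" using 3 by auto
  have IH: "key_at (Suc k) ((s # \<nu>) @ [b]) = (\<Sum>a=s..b. z ^ (b - a) * h a)" if "r \<le> b" for b
    using 3 that by (simp add: z_def h_def)
  have "key_at k ((r # s # \<nu>) @ [p]) = (\<Sum>b=r..p. x ^ (p + r - b) * (\<Sum>a=s..b. z ^ (b - a) * h a))"
    using key_at_Cons_insert[of r p "s # \<nu>" "[]" k] 3 IH by (auto simp: x_def)
  also have "\<dots> = (\<Sum>b=r..p. \<Sum>a=s..b. x ^ (p + r - b) * z ^ (b - a) * h a)"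
    by (simp add: sum_distrib_left mult.assoc)
  also have "\<dots> = (\<Sum>b=r..p. \<Sum>a=s..<r. x ^ (p + r - b) * z ^ (b - a) * h a) +
      (\<Sum>a=r..p. \<Sum>b=a..p. x ^ (p + r - b) * z ^ (b - a) * h a)"
    by (rule sum_triangle_split) fact
  also have "(\<Sum>b=r..p. \<Sum>a=s..<r. x ^ (p + r - b) * z ^ (b - a) * h a) =
      (\<Sum>a=r..p. \<Sum>b=s..<r. x ^ a * z ^ (p + r - a - b) * h b)"
    by (rule sum.reindex_bij_witness[where i = "\<lambda>b. p + r - b" and j = "\<lambda>b. p + r - b"]) auto
  also have "(\<Sum>a=r..p. \<Sum>b=a..p. x ^ (p + r - b) * z ^ (b - a) * h a) =
      (\<Sum>b=r..p. \<Sum>a=b..p. x ^ (a + r - b) * z ^ (p - a) * h b)"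
  proof (rule sum.cong)
    fix b
    show "(\<Sum>a=b..p. x ^ (p + r - a) * z ^ (a - b) * h b) =
        (\<Sum>a=b..p. x ^ (a + r - b) * z ^ (p - a) * h b)"
      by (rule sum.reindex_bij_witness[where i = "\<lambda>a. p + b - a" and j = "\<lambda>a. p + b - a"])
        (auto simp: algebra_simps)
  qed simp
  also have "\<dots> = (\<Sum>a=r..p. \<Sum>b=r..a. x ^ (a + r - b) * z ^ (p - a) * h b)"
    by (rule sum_triangle_swap[symmetric])
  also have "(\<Sum>a=r..p. \<Sum>b=s..<r. x ^ a * z ^ (p + r - a - b) * h b) + \<dots> =
      (\<Sum>a=r..p. z ^ (p - a) * ((\<Sum>b=r..a. x ^ (a + r - b) * h b) + (\<Sum>b=s..<r. z ^ (r - b) * x ^ a * h b)))"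
  proof -
    have "z ^ (p - a) * ((\<Sum>b=r..a. x ^ (a + r - b) * h b) + (\<Sum>b=s..<r. z ^ (r - b) * x ^ a * h b)) =
        (\<Sum>b=s..<r. x ^ a * z ^ (p + r - a - b) * h b) + (\<Sum>b=r..a. x ^ (a + r - b) * z ^ (p - a) * h b)"
      if "a \<in> {r..p}" for a
    proof -
      have "z ^ (p + r - a - b) = z ^ (p - a) * z ^ (r - b)" if "b < r" for b
        using that \<open>a \<in> {r..p}\<close> by (simp flip: power_add)
      thus ?thesis by (simp add: distrib_left sum_distrib_left mult_ac)
    qed
    thus ?thesis by (simp add: sum.distrib)
  qed
  also have "\<dots> = (\<Sum>a=r..p. z ^ (p - a) * strip_sum k a (r # s # \<nu>))"
    using 3 by (intro sum.cong) (simp_all add: strip_sum_Cons x_def z_def h_def)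
  finally show ?case by (simp add: z_def)
qed simp


section \<open>The right-inversion sum and the size of the branching\<close>

text \<open>
  Truncated subtraction makes the pairs that are not right inversions contribute \<open>0\<close>.
\<close>

primrec inversion_weight :: "nat list \<Rightarrow> nat" where
  "inversion_weight [] = 0"
| "inversion_weight (x # xs) = (\<Sum>y\<leftarrow>xs. y - x) + inversion_weight xs"

lemma inversion_weight_snoc: "inversion_weight (xs @ [p]) = inversion_weight xs + (\<Sum>x\<leftarrow>xs. p - x)"
  by (induction xs) simp_all

lemma sum_list_diff_eq_0: "\<forall>x\<in>set xs. x \<le> a \<Longrightarrow> (\<Sum>x\<leftarrow>xs. x - a) = (0 :: nat)"
  by (induction xs) simp_all

lemma inversion_weight_Cons_max: "\<forall>x\<in>set xs. x \<le> a \<Longrightarrow> inversion_weight (a # xs) = inversion_weight xs"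
  by (simp add: sum_list_diff_eq_0)

lemma inversion_weight_sorted: "sorted_wrt (\<ge>) xs \<Longrightarrow> inversion_weight xs = 0"
  by (induction xs) (simp_all add: sum_list_diff_eq_0)

lemma inversion_weight_swap_le:
  "a \<le> b \<Longrightarrow> inversion_weight (us @ b # a # vs) \<le> inversion_weight (us @ a # b # vs)"
  by (induction us) simp_all

definition strip_count :: "nat \<Rightarrow> nat list \<Rightarrow> nat" where
  "strip_count a \<nu> = (\<Sum>(w, c, d)\<leftarrow>strip_contexts \<nu>. 1 + inversion_weight (c @ a # d))"

lemma strip_count_Cons:
  assumes sorted: "sorted_wrt (\<ge>) (r # s # \<nu>)" and "r \<le> a"
  shows "strip_count a (r # s # \<nu>) = strip_count a (s # \<nu>) +
    length (strip_contexts (s # \<nu>)) * (a - r) + (\<Sum>b=s..<r. strip_count b (s # \<nu>))"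
proof -
  define C where "C = strip_contexts (s # \<nu>)"
  have le: "\<forall>x\<in>set (c @ d). x \<le> r" if "(w, c, d) \<in> set C" for w c d
    using strip_contexts_le[of "s # \<nu>" w c d] that sorted unfolding C_def by fastforce
  have 1: "(\<Sum>(w, c, d)\<leftarrow>C. 1 + inversion_weight (r # c @ a # d)) =
      strip_count a (s # \<nu>) + length C * (a - r)"
  proof -
    have "inversion_weight (r # c @ a # d) = inversion_weight (c @ a # d) + (a - r)"
      if "(w, c, d) \<in> set C" for w c d
      using le[OF that] by (simp add: sum_list_diff_eq_0)
    hence "(\<Sum>(w, c, d)\<leftarrow>C. 1 + inversion_weight (r # c @ a # d)) =
        (\<Sum>(w, c, d)\<leftarrow>C. (1 + inversion_weight (c @ a # d)) + (a - r))"
      by (intro arg_cong[of _ _ sum_list] map_cong refl) force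
    also have "\<dots> = strip_count a (s # \<nu>) + length C * (a - r)"
      unfolding strip_count_def C_def[symmetric] case_prod_unfold
      by (simp only: sum_list_addf sum_list_triv of_nat_id)
    finally show ?thesis .
  qed
  have 2: "(\<Sum>(w, c, d)\<leftarrow>C. 1 + inversion_weight (a # c @ b # d)) = strip_count b (s # \<nu>)"
    if "b < r" for b
  proof -
    have "inversion_weight (a # c @ b # d) = inversion_weight (c @ b # d)"
      if "(w, c, d) \<in> set C" for w c d
      using le[OF that] \<open>r \<le> a\<close> \<open>b < r\<close> by (intro inversion_weight_Cons_max) (auto intro: order.trans[OF _ \<open>r \<le> a\<close>])
    thus ?thesis unfolding strip_count_def C_def[symmetric]
      by (intro arg_cong[of _ _ sum_list] map_cong refl) force
  qed
  have "strip_count a (r # s # \<nu>) =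
      (\<Sum>(w, c, d)\<leftarrow>C. 1 + inversion_weight (r # c @ a # d)) +
      (\<Sum>b\<leftarrow>[s..<r]. \<Sum>(w, c, d)\<leftarrow>C. 1 + inversion_weight (a # c @ b # d))"
    unfolding strip_count_def strip_contexts.simps C_def[symmetric]
    by (simp add: map_concat sum_list_concat_map o_def case_prod_unfold)
  also have "(\<Sum>b\<leftarrow>[s..<r]. \<Sum>(w, c, d)\<leftarrow>C. 1 + inversion_weight (a # c @ b # d)) =
      (\<Sum>b=s..<r. strip_count b (s # \<nu>))"
    unfolding interv_sum_list_conv_sum_set_nat set_upt using 2 by (intro sum.cong) auto
  finally show ?thesis unfolding 1 unfolding C_def .
qed

text \<open>
  By \<open>strip_count_Cons\<close> the sum for \<open>r # s # \<nu>\<close> consists of the sum for \<open>s # \<nu>\<close>, where the terms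
  \<open>b < r\<close> are supplied by the case \<open>a = r\<close>, and of a surplus for each \<open>a > r\<close>. The surplus is at
  least \<open>a - r \<ge> 1\<close>, and there are \<open>p - r\<close> such \<open>a\<close>, as many as \<open>r\<close> adds to the left-hand side.
\<close>

lemma strip_count_ge:
  assumes "sorted_wrt (\<ge>) \<nu>" "\<nu> \<noteq> []" "hd \<nu> \<le> p"
  shows "1 + (\<Sum>x\<leftarrow>\<nu>. p - x) \<le> (\<Sum>a=hd \<nu>..p. strip_count a \<nu>)"
  using assms
proof (induction \<nu> arbitrary: p rule: strip_contexts.induct)
  case (2 r)
  thus ?case by (simp add: strip_count_def)
next
  case (3 r s \<nu>)
  have "s \<le> r" "r \<le> p" and sorted: "sorted_wrt (\<ge>) (s # \<nu>)" using 3 by auto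
  define T where "T = (\<lambda>a. strip_count a (s # \<nu>))"
  define n where "n = length (strip_contexts (s # \<nu>))"
  have "n \<ge> 1" using strip_contexts_top[OF sorted] by (cases "strip_contexts (s # \<nu>)") (auto simp: n_def)
  \<comment> \<open>\<open>e a\<close> is what \<open>strip_count_Cons\<close> adds to \<open>T a\<close>; \<open>e r\<close> completes the range of summation to
    start at \<open>s\<close>.\<close>
  define e where "e = (\<lambda>a. n * (a - r) + (\<Sum>b=s..<r. T b))"
  have "(\<Sum>a=r..p. strip_count a (r # s # \<nu>)) = (\<Sum>a=r..p. T a + e a)"
    using 3 by (intro sum.cong) (simp_all add: strip_count_Cons T_def n_def e_def)
  also have "\<dots> = (\<Sum>a=r..p. T a) + (e r + (\<Sum>a=Suc r..p. e a))"
    using \<open>r \<le> p\<close> by (simp add: sum.distrib sum.atLeast_Suc_atMost)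
  also have "\<dots> = (\<Sum>a=s..p. T a) + (\<Sum>a=Suc r..p. e a)"
  proof -
    have "{s..p} = {s..<r} \<union> {r..p}" "{s..<r} \<inter> {r..p} = {}"
      using \<open>s \<le> r\<close> \<open>r \<le> p\<close> by auto
    thus ?thesis by (simp add: e_def sum.union_disjoint)
  qed
  finally have eq: "(\<Sum>a=r..p. strip_count a (r # s # \<nu>)) = \<dots>" .
  have "1 + (\<Sum>x\<leftarrow>s # \<nu>. p - x) \<le> (\<Sum>a=s..p. T a)"
    using "3.IH"(2)[of p] 3 by (simp add: T_def)
  moreover have "p - r \<le> (\<Sum>a=Suc r..p. e a)"
  proof -
    have "(\<Sum>a=Suc r..p. 1) \<le> (\<Sum>a=Suc r..p. e a)"
      using \<open>n \<ge> 1\<close> by (intro sum_mono) (auto simp: e_def Suc_le_eq)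
    thus ?thesis by simp
  qed
  ultimately show ?case using eq by simp
qed simp

section \<open>Splitting off the last variable\<close>

text \<open>
  Entries that are at least \<open>p\<close> form a prefix, which is split off as a monomial and put back in front
  of each \<open>\<gamma>\<close>; the bound \<open>m\<close> ensures that it is still maximal there. What remains
  has all entries below \<open>p\<close> and is covered by \<open>key_at_branching\<close>.
\<close>

lemma key_at_snoc_expansion_sorted:
  assumes "sorted_wrt (\<ge>) xs" "\<forall>y\<in>set xs. y \<le> m" "p \<le> m"
  shows "\<exists>w \<Gamma>. key_at k (xs @ [p]) = var (k + length xs) ^ w * key_at k xs +
      (\<Sum>(v, \<gamma>)\<leftarrow>\<Gamma>. var (k + length xs) ^ v * key_at k \<gamma>) \<and>
    (\<forall>(v, \<gamma>)\<in>set \<Gamma>. length \<gamma> = length xs \<and> (\<forall>y\<in>set \<gamma>. y \<le> m)) \<and>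
    (\<Sum>x\<leftarrow>xs. p - x) \<le> (\<Sum>(v, \<gamma>)\<leftarrow>\<Gamma>. 1 + inversion_weight \<gamma>)"
  using assms
proof (induction xs arbitrary: k m)
  case Nil
  show ?case
    by (rule exI[of _ p], rule exI[of _ "[]"]) (simp add: key_at_sorted)
next
  case (Cons x xs)
  show ?case
  proof (cases "p \<le> x")
    case True
    have le: "\<forall>y\<in>set xs. y \<le> x" using Cons by simp
    let ?z = "var (k + length (x # xs))"
    obtain w \<Gamma> where eq: "key_at (Suc k) (xs @ [p]) = ?z ^ w * key_at (Suc k) xs +
        (\<Sum>(v, \<gamma>)\<leftarrow>\<Gamma>. ?z ^ v * key_at (Suc k) \<gamma>)"
      and \<Gamma>: "\<forall>(v, \<gamma>)\<in>set \<Gamma>. length \<gamma> = length xs \<and> (\<forall>y\<in>set \<gamma>. y \<le> x)"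
      and ge: "(\<Sum>x\<leftarrow>xs. p - x) \<le> (\<Sum>(v, \<gamma>)\<leftarrow>\<Gamma>. 1 + inversion_weight \<gamma>)"
      using Cons.IH[OF _ le True, of "Suc k"] Cons.prems by auto
    let ?\<Gamma> = "map (\<lambda>(v, \<gamma>). (v, x # \<gamma>)) \<Gamma>"
    have "(\<Sum>(v, \<gamma>)\<leftarrow>\<Gamma>. ?z ^ v * key_at k (x # \<gamma>)) =
        (\<Sum>(v, \<gamma>)\<leftarrow>\<Gamma>. var k ^ x * (?z ^ v * key_at (Suc k) \<gamma>))"
      using \<Gamma> by (intro arg_cong[of _ _ sum_list] map_cong refl) (auto simp: key_at_Cons mult_ac)
    moreover have "key_at k (x # xs @ [p]) = var k ^ x * key_at (Suc k) (xs @ [p])"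
      "key_at k (x # xs) = var k ^ x * key_at (Suc k) xs"
      using le True by (auto intro!: key_at_Cons)
    ultimately have "key_at k ((x # xs) @ [p]) = ?z ^ w * key_at k (x # xs) +
        (\<Sum>(v, \<gamma>)\<leftarrow>?\<Gamma>. ?z ^ v * key_at k \<gamma>)"
      using eq by (simp add: o_def case_prod_unfold sum_list_const_mult distrib_left mult_ac)
    moreover have "\<forall>(v, \<gamma>)\<in>set ?\<Gamma>. length \<gamma> = length (x # xs) \<and> (\<forall>y\<in>set \<gamma>. y \<le> m)"
      using \<Gamma> Cons.prems by fastforce
    moreover have "(\<Sum>(v, \<gamma>)\<leftarrow>?\<Gamma>. 1 + inversion_weight \<gamma>) = (\<Sum>(v, \<gamma>)\<leftarrow>\<Gamma>. 1 + inversion_weight \<gamma>)"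
      unfolding map_map using \<Gamma>
      by (intro arg_cong[of _ _ sum_list] map_cong refl) (auto simp: sum_list_diff_eq_0)
    ultimately show ?thesis using ge True by (intro exI[of _ w] exI[of _ ?\<Gamma>]) simp
  next
    case False
    let ?\<nu> = "x # xs"
    let ?z = "var (k + length ?\<nu>)"
    define \<Gamma> where "\<Gamma> = concat (map (\<lambda>a. map (\<lambda>(w, c, d). (p - a + w, c @ a # d))
      (strip_contexts ?\<nu>)) [x..<Suc p])"
    have upt: "set [x..<Suc p] = {x..p}" by auto
    have total: "key_at k (?\<nu> @ [p]) = (\<Sum>(v, \<gamma>)\<leftarrow>\<Gamma>. ?z ^ v * key_at k \<gamma>)"
    proof -
      have "(\<Sum>(v, \<gamma>)\<leftarrow>\<Gamma>. ?z ^ v * key_at k \<gamma>) =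
          (\<Sum>a\<leftarrow>[x..<Suc p]. ?z ^ (p - a) * strip_sum k a ?\<nu>)"
        unfolding \<Gamma>_def strip_sum_def
        by (simp add: map_concat sum_list_concat_map o_def case_prod_unfold power_add mult.assoc
            sum_list_const_mult del: upt_Suc)
      thus ?thesis using key_at_branching[of ?\<nu> p k] Cons.prems False
        by (simp add: interv_sum_list_conv_sum_set_nat upt del: upt_Suc set_upt)
    qed
    have count: "1 + (\<Sum>y\<leftarrow>?\<nu>. p - y) \<le> (\<Sum>(v, \<gamma>)\<leftarrow>\<Gamma>. 1 + inversion_weight \<gamma>)"
    proof -
      have "(\<Sum>(v, \<gamma>)\<leftarrow>\<Gamma>. 1 + inversion_weight \<gamma>) = (\<Sum>a\<leftarrow>[x..<Suc p]. strip_count a ?\<nu>)"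
        unfolding \<Gamma>_def strip_count_def
        by (simp add: map_concat sum_list_concat_map o_def case_prod_unfold del: upt_Suc)
      thus ?thesis using strip_count_ge[of ?\<nu> p] Cons.prems False
        by (simp add: interv_sum_list_conv_sum_set_nat upt del: upt_Suc set_upt)
    qed
    obtain w c d where wcd: "(w, c, d) \<in> set (strip_contexts ?\<nu>)" "c @ x # d = ?\<nu>"
      using strip_contexts_top[of ?\<nu>] Cons.prems by auto
    have "(p - x + w, c @ x # d) \<in> set \<Gamma>"
      unfolding \<Gamma>_def using wcd(1) False by (force simp del: upt_Suc)
    hence mem: "(p - x + w, ?\<nu>) \<in> set \<Gamma>" unfolding wcd(2) .
    \<comment> \<open>The term of \<open>?\<nu>\<close> accounts for the \<open>1\<close> in \<open>count\<close>, since a partition has no right inversions.\<close>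
    let ?\<Gamma> = "remove1 (p - x + w, ?\<nu>) \<Gamma>"
    have "key_at k (?\<nu> @ [p]) = ?z ^ (p - x + w) * key_at k ?\<nu> + (\<Sum>(v, \<gamma>)\<leftarrow>?\<Gamma>. ?z ^ v * key_at k \<gamma>)"
      unfolding total sum_list_map_remove1[OF mem] by simp
    moreover have "(\<Sum>y\<leftarrow>?\<nu>. p - y) \<le> (\<Sum>(v, \<gamma>)\<leftarrow>?\<Gamma>. 1 + inversion_weight \<gamma>)"
      using count inversion_weight_sorted[of ?\<nu>] Cons.prems(1)
      unfolding sum_list_map_remove1[OF mem] by (simp del: inversion_weight.simps)
    moreover have "\<forall>(v, \<gamma>)\<in>set ?\<Gamma>. length \<gamma> = length ?\<nu> \<and> (\<forall>y\<in>set \<gamma>. y \<le> m)"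
    proof -
      have "length \<gamma> = length ?\<nu> \<and> (\<forall>y\<in>set \<gamma>. y \<le> m)" if in\<Gamma>: "(v, \<gamma>) \<in> set \<Gamma>" for v \<gamma>
      proof -
        obtain a w c d where acd: "a \<le> p" "(w, c, d) \<in> set (strip_contexts ?\<nu>)" "\<gamma> = c @ a # d"
          using in\<Gamma> unfolding \<Gamma>_def set_concat set_map upt by auto
        have "\<forall>y\<in>set (c @ d). y \<le> x"
          using strip_contexts_le[OF Cons.prems(1) acd(2)] by simp
        moreover have "x \<le> m" using Cons.prems(2) by simp
        ultimately have "\<forall>y\<in>set \<gamma>. y \<le> m"
          using acd(1) Cons.prems(3) unfolding acd(3) by (auto intro: order.trans[OF _ \<open>x \<le> m\<close>])
        thus ?thesis using strip_contexts_length[OF acd(2)] acd(3) by simp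
      qed
      thus ?thesis using set_remove1_subset[of "(p - x + w, ?\<nu>)" \<Gamma>] by blast
    qed
    ultimately show ?thesis by (intro exI[of _ "p - x + w"] exI[of _ ?\<Gamma>] conjI)
  qed
qed

text \<open>
  The action of \<open>dem\<close> on indices of key polynomials: descents are exchanged, all else is kept.
\<close>

definition swap_up :: "nat \<Rightarrow> nat list \<Rightarrow> nat list" where
  "swap_up i xs = (if xs ! Suc i < xs ! i then xs[i := xs ! Suc i, Suc i := xs ! i] else xs)"

lemma swap_up_append: "swap_up (length us) (us @ a # b # vs) = us @ min a b # max a b # vs"
  by (simp add: swap_up_def nth_append list_update_append min_def max_def)

lemma dem_key_at_swap_up:
  assumes "Suc i < length xs"
  shows "dem (k + i) (key_at k xs) = key_at k (swap_up i xs)"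
    and "inversion_weight xs \<le> inversion_weight (swap_up i xs)"
    and "length (swap_up i xs) = length xs"
proof -
  have "xs = take i xs @ xs ! i # xs ! Suc i # drop (Suc (Suc i)) xs"
    using assms by (simp add: Cons_nth_drop_Suc)
  then obtain us a b vs where xs: "xs = us @ a # b # vs" "length us = i"
    using assms by (metis Suc_lessD length_take min.absorb4)
  have up: "swap_up i xs = us @ min a b # max a b # vs"
    unfolding xs(1) xs(2)[symmetric] by (rule swap_up_append)
  show "dem (k + i) (key_at k xs) = key_at k (swap_up i xs)"
  proof (cases "a \<le> b")
    case True
    thus ?thesis using dem_key_at_ascent[OF True, of k us vs] xs up by simp
  next
    case False
    thus ?thesis using key_at_ascent[of b a k us vs] xs up by simp
  qed
  show "inversion_weight xs \<le> inversion_weight (swap_up i xs)"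
    using inversion_weight_swap_le[of b a us vs] xs(1) up by (cases "a \<le> b") simp_all
  show "length (swap_up i xs) = length xs"
    using xs(1) up by simp
qed

text \<open>
  The operator that exchanges two entries of \<open>xs\<close> fixes the last variable, so it can be applied to
  the expansion term by term.
\<close>

lemma key_at_snoc_expansion:
  "\<exists>w \<Gamma>. key_at k (xs @ [p]) = var (k + length xs) ^ w * key_at k xs +
      (\<Sum>(v, \<gamma>)\<leftarrow>\<Gamma>. var (k + length xs) ^ v * key_at k \<gamma>) \<and>
    (\<forall>(v, \<gamma>)\<in>set \<Gamma>. length \<gamma> = length xs) \<and>
    (\<Sum>x\<leftarrow>xs. p - x) \<le> (\<Sum>(v, \<gamma>)\<leftarrow>\<Gamma>. 1 + inversion_weight \<gamma>)"
proof (induction xs rule: adjacent_swap_induct)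
  case (sorted xs)
  thus ?case
    using key_at_snoc_expansion_sorted[of xs "Max (set (p # xs))" p k] by fastforce
next
  case (ascent us a b vs)
  let ?xs = "us @ b # a # vs" and ?ys = "us @ a # b # vs" and ?i = "length us"
  let ?z = "var (k + length ?xs)"
  obtain w \<Gamma> where eq: "key_at k (?xs @ [p]) = ?z ^ w * key_at k ?xs +
      (\<Sum>(v, \<gamma>)\<leftarrow>\<Gamma>. ?z ^ v * key_at k \<gamma>)"
    and \<Gamma>: "\<forall>(v, \<gamma>)\<in>set \<Gamma>. length \<gamma> = length ?xs"
    and ge: "(\<Sum>x\<leftarrow>?xs. p - x) \<le> (\<Sum>(v, \<gamma>)\<leftarrow>\<Gamma>. 1 + inversion_weight \<gamma>)"
    using ascent by blast
  let ?\<Gamma> = "map (\<lambda>(v, \<gamma>). (v, swap_up ?i \<gamma>)) \<Gamma>"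
  have z: "dem (k + ?i) (?z ^ n * f) = ?z ^ n * dem (k + ?i) f" for n f
    by (rule dem_mult_invariant) (simp add: swap_vars_power swap_vars_var transpose_def)
  have key: "key_at k ?ys = dem (k + ?i) (key_at k ?xs)"
    by (rule key_at_ascent_less) fact
  have "key_at k (?ys @ [p]) = dem (k + ?i) (key_at k (?xs @ [p]))"
    using key_at_ascent_less[OF \<open>a < b\<close>, of k us "vs @ [p]"] by simp
  also have "\<dots> = ?z ^ w * key_at k ?ys + (\<Sum>(v, \<gamma>)\<leftarrow>\<Gamma>. ?z ^ v * dem (k + ?i) (key_at k \<gamma>))"
    unfolding eq dem_add dem_sum_list case_prod_unfold z key ..
  also have "(\<Sum>(v, \<gamma>)\<leftarrow>\<Gamma>. ?z ^ v * dem (k + ?i) (key_at k \<gamma>)) =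
      (\<Sum>(v, \<gamma>)\<leftarrow>?\<Gamma>. ?z ^ v * key_at k \<gamma>)"
    unfolding map_map using \<Gamma>
    by (intro arg_cong[of _ _ sum_list] map_cong refl) (auto simp: dem_key_at_swap_up)
  finally have "key_at k (?ys @ [p]) = ?z ^ w * key_at k ?ys + (\<Sum>(v, \<gamma>)\<leftarrow>?\<Gamma>. ?z ^ v * key_at k \<gamma>)" .
  moreover have "\<forall>(v, \<gamma>)\<in>set ?\<Gamma>. length \<gamma> = length ?ys"
    using \<Gamma> by (auto simp: dem_key_at_swap_up(3))
  moreover have "(\<Sum>x\<leftarrow>?ys. p - x) \<le> (\<Sum>(v, \<gamma>)\<leftarrow>?\<Gamma>. 1 + inversion_weight \<gamma>)"
  proof -
    have "(\<Sum>(v, \<gamma>)\<leftarrow>\<Gamma>. 1 + inversion_weight \<gamma>) \<le> (\<Sum>(v, \<gamma>)\<leftarrow>?\<Gamma>. 1 + inversion_weight \<gamma>)"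
      unfolding map_map using \<Gamma> by (intro sum_list_mono) (auto simp: dem_key_at_swap_up(2))
    thus ?thesis using ge by simp
  qed
  ultimately show ?case by (intro exI[of _ w] exI[of _ ?\<Gamma>]) simp
qed

section \<open>Evaluation at ones\<close>

abbreviation eval_ones :: "mpoly \<Rightarrow> int" where
  "eval_ones \<equiv> eval_mpoly (\<lambda>_. 1)"

lemma eval_ones_superset:
  "finite A \<Longrightarrow> Poly_Mapping.keys f \<subseteq> A \<Longrightarrow> eval_ones f = (\<Sum>m\<in>A. Poly_Mapping.lookup f m)"
  unfolding eval_mpoly_def by (auto intro!: sum.mono_neutral_left simp: in_keys_iff)

lemma eval_ones_add: "eval_ones (f + g) = eval_ones f + eval_ones g"
  using eval_ones_superset[of "Poly_Mapping.keys f \<union> Poly_Mapping.keys g"] Poly_Mapping.keys_add[of f g]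
  by (simp add: lookup_add sum.distrib)

lemma eval_ones_zero [simp]: "eval_ones 0 = 0"
  by (simp add: eval_mpoly_def)

lemma eval_ones_single [simp]: "eval_ones (Poly_Mapping.single m c) = c"
  using eval_ones_superset[of "{m}" "Poly_Mapping.single m c"] by simp

lemma eval_ones_sum_list: "eval_ones (sum_list (map f xs)) = (\<Sum>x\<leftarrow>xs. eval_ones (f x))"
  by (induction xs) (simp_all add: eval_ones_add)

lemma eval_ones_var_power_mult: "eval_ones (var i ^ n * f) = eval_ones f"
  by (induction f rule: poly_mapping_single_induct)
    (simp_all add: var_power mult_single eval_ones_add distrib_left)

theorem eval_ones_key_at_ge: "1 + int (inversion_weight xs) \<le> eval_ones (key_at k xs)"
proof (induction "length xs" arbitrary: xs)
  case 0
  thus ?case by (simp add: key_at_sorted flip: single_one)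
next
  case (Suc n)
  then obtain ys p where xs: "xs = ys @ [p]" and n: "n = length ys"
    by (cases xs rule: rev_cases) auto
  obtain w \<Gamma> where eq: "key_at k (ys @ [p]) = var (k + length ys) ^ w * key_at k ys +
      (\<Sum>(v, \<gamma>)\<leftarrow>\<Gamma>. var (k + length ys) ^ v * key_at k \<gamma>)"
    and \<Gamma>: "\<forall>(v, \<gamma>)\<in>set \<Gamma>. length \<gamma> = length ys"
    and ge: "(\<Sum>x\<leftarrow>ys. p - x) \<le> (\<Sum>(v, \<gamma>)\<leftarrow>\<Gamma>. 1 + inversion_weight \<gamma>)"
    using key_at_snoc_expansion by blast
  have "1 + int (inversion_weight xs) \<le>
      (1 + int (inversion_weight ys)) + int (\<Sum>(v, \<gamma>)\<leftarrow>\<Gamma>. 1 + inversion_weight \<gamma>)"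
    using ge by (simp add: xs inversion_weight_snoc)
  also have "int (\<Sum>(v, \<gamma>)\<leftarrow>\<Gamma>. 1 + inversion_weight \<gamma>) = (\<Sum>(v, \<gamma>)\<leftarrow>\<Gamma>. 1 + int (inversion_weight \<gamma>))"
    by (induction \<Gamma>) auto
  also have "\<dots> \<le> (\<Sum>(v, \<gamma>)\<leftarrow>\<Gamma>. eval_ones (key_at k \<gamma>))"
    using Suc.hyps(1) \<Gamma> n by (intro sum_list_mono) auto
  also have "1 + int (inversion_weight ys) \<le> eval_ones (key_at k ys)"
    by (rule Suc.hyps(1)) (rule n)
  also have "eval_ones (key_at k ys) + (\<Sum>(v, \<gamma>)\<leftarrow>\<Gamma>. eval_ones (key_at k \<gamma>)) =
      eval_ones (key_at k xs)"
    unfolding xs eq by (simp add: eval_ones_add eval_ones_sum_list eval_ones_var_power_mult case_prod_unfold)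
  finally show ?case by simp
qed

lemma inversion_weight_map_upt:
  "int (inversion_weight (map f [0..<n])) = (\<Sum>(i, j) | i < j \<and> j < n \<and> f i < f j. int (f j) - int (f i))"
proof (induction n)
  case (Suc n)
  let ?A = "\<lambda>n. {(i, j). i < j \<and> j < n \<and> f i < f j}"
  have fin: "finite (?A n)" for n
    by (rule finite_subset[of _ "{..<n} \<times> {..<n}"]) auto
  have "?A (Suc n) = ?A n \<union> (\<lambda>i. (i, n)) ` {i. i < n \<and> f i < f n}"
    by (auto simp: less_Suc_eq)
  hence "(\<Sum>(i, j)\<in>?A (Suc n). int (f j) - int (f i)) =
      (\<Sum>(i, j)\<in>?A n. int (f j) - int (f i)) + (\<Sum>(i, j)\<in>(\<lambda>i. (i, n)) ` {i. i < n \<and> f i < f n}. int (f j) - int (f i))"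
    using fin by (subst sum.union_disjoint[symmetric]) auto
  also have "(\<Sum>(i, j)\<in>(\<lambda>i. (i, n)) ` {i. i < n \<and> f i < f n}. int (f j) - int (f i)) =
      (\<Sum>i | i < n \<and> f i < f n. int (f n) - int (f i))"
    by (subst sum.reindex) (auto simp: inj_on_def)
  also have "\<dots> = (\<Sum>i\<in>{0..<n}. int (f n - f i))"
    by (rule sum.mono_neutral_cong_left) (auto simp: of_nat_diff)
  also have "\<dots> = int (\<Sum>x\<leftarrow>map f [0..<n]. f n - x)"
    by (simp add: interv_sum_list_conv_sum_set_nat o_def)
  finally show ?case using Suc by (simp add: inversion_weight_snoc)
qed simp

theorem corollary3p5:
  fixes \<alpha> :: composition
  shows "eval_mpoly (\<lambda>_. 1) (key_poly \<alpha>) \<ge>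
    1 + (\<Sum>(i, j)\<in>rinv \<alpha>. int (Poly_Mapping.lookup \<alpha> j) - int (Poly_Mapping.lookup \<alpha> i))"
proof -
  \<comment> \<open>Entries with index at least \<open>n\<close> vanish, so they are not the larger entry of a right inversion.\<close>
  define n where "n = Suc (Max (insert 0 (Poly_Mapping.keys \<alpha>)))"
  define xs where "xs = map (Poly_Mapping.lookup \<alpha>) [0..<n]"
  have zero: "Poly_Mapping.lookup \<alpha> i = 0" if "n \<le> i" for i
  proof (rule ccontr)
    assume "Poly_Mapping.lookup \<alpha> i \<noteq> 0"
    hence "i \<le> Max (insert 0 (Poly_Mapping.keys \<alpha>))" by (simp add: in_keys_iff)
    thus False using that by (simp add: n_def)
  qed
  hence "Poly_Mapping.nth xs = \<alpha>"
    by (intro poly_mapping_eqI) (auto simp: xs_def nth.rep_eq nth_default_def)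
  moreover have "rinv \<alpha> = {(i, j). i < j \<and> j < n \<and> Poly_Mapping.lookup \<alpha> i < Poly_Mapping.lookup \<alpha> j}"
    using zero by (auto simp: rinv_def) (metis not_le not_less0)
  ultimately show ?thesis
    using eval_ones_key_at_ge[of xs 0] by (simp add: key_at_0 xs_def inversion_weight_map_upt)
qed

end
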